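(* Let $\mathcal{K}$ be a large finitely accessible category. Then there exists a faithful functor $\mathbf{Lin}\to\mathcal{K}$ which preserves directed colimits.
   Context: $\mathbf{Lin}$ is the category whose objects are linearly ordered sets and whose morphisms are the order preserving injective mappings. A (locally small) category $\mathcal{K}$ is finitely accessible if it has all directed colimits and there is a set $\mathcal{A}$ of finitely presentable objects of $\mathcal{K}$ such that every object of $\mathcal{K}$ is a directed colimit of objects from $\mathcal{A}$; an object $A$ is finitely presentable if $\mathcal{K}(A,-):\mathcal{K}\to\mathbf{Set}$ preserves directed colimits. "Large" means not equivalent to a small category, i.e. $\mathcal{K}$ does not have only a set of objects up to isomorphism. *)

theory Defs
  imports Main "HOL-Library.FuncSet"
begin

unbundle cardinal_syntax

section \<open>Sets and classes\<close>

text \<open>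
  Sizes are measured in a Grothendieck universe. The universe is the type \<open>'u\<close>, whose
  cardinality is assumed (in the theorem) to be inaccessible, so that \<open>'u\<close> is in bijection with
  some \<open>V\<^sub>\<kappa>\<close>. Under any such bijection the elements of \<open>V\<^sub>\<kappa>\<close> correspond exactly to the small
  subsets of \<open>'u\<close>, and the classes to arbitrary subsets of \<open>'u\<close>.
\<close>

definition inaccessible :: "'a rel \<Rightarrow> bool" where
  "inaccessible r \<longleftrightarrow> Card_order r \<and> natLeq <o r \<and> regularCard r \<and>
     (\<forall>A :: 'a set. |A| <o r \<longrightarrow> |Pow A| <o r)"

definition small :: "'u set \<Rightarrow> bool" where
  "small A \<longleftrightarrow> |A| <o |UNIV :: 'u set|"


section \<open>Categories and functors\<close>

record ('o, 'a) cat =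
  Obj :: "'o set"
  Arr :: "'a set"
  Dom :: "'a \<Rightarrow> 'o"
  Cod :: "'a \<Rightarrow> 'o"
  Ide :: "'o \<Rightarrow> 'a"
  Comp :: "'a \<Rightarrow> 'a \<Rightarrow> 'a"  \<comment> \<open>\<open>Comp C g f\<close> is \<open>g\<close> after \<open>f\<close>\<close>

definition Hom :: "('o, 'a) cat \<Rightarrow> 'o \<Rightarrow> 'o \<Rightarrow> 'a set" where
  "Hom C x y = {f \<in> Arr C. Dom C f = x \<and> Cod C f = y}"

locale category =
  fixes C :: "('o, 'a) cat"
  assumes Dom_in_Obj: "f \<in> Arr C \<Longrightarrow> Dom C f \<in> Obj C"
    and Cod_in_Obj: "f \<in> Arr C \<Longrightarrow> Cod C f \<in> Obj C"
    and Ide_in_Hom: "x \<in> Obj C \<Longrightarrow> Ide C x \<in> Hom C x x"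
    and Comp_in_Hom: "f \<in> Hom C x y \<Longrightarrow> g \<in> Hom C y z \<Longrightarrow> Comp C g f \<in> Hom C x z"
    and Comp_Ide: "f \<in> Hom C x y \<Longrightarrow> Comp C f (Ide C x) = f"
    and Ide_Comp: "f \<in> Hom C x y \<Longrightarrow> Comp C (Ide C y) f = f"
    and Comp_assoc: "f \<in> Hom C w x \<Longrightarrow> g \<in> Hom C x y \<Longrightarrow> h \<in> Hom C y z \<Longrightarrow>
      Comp C (Comp C h g) f = Comp C h (Comp C g f)"

definition isomorphic :: "('o, 'a) cat \<Rightarrow> 'o \<Rightarrow> 'o \<Rightarrow> bool" where
  "isomorphic C x y \<longleftrightarrow> (\<exists>f \<in> Hom C x y. \<exists>g \<in> Hom C y x.
     Comp C g f = Ide C x \<and> Comp C f g = Ide C y)"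

record ('o, 'a, 'p, 'b) func =
  omap :: "'o \<Rightarrow> 'p"
  amap :: "'a \<Rightarrow> 'b"

locale cat_functor = C: category C + D: category D
  for C :: "('o, 'a) cat" and D :: "('p, 'b) cat" +
  fixes F :: "('o, 'a, 'p, 'b) func"
  assumes omap_in_Obj: "x \<in> Obj C \<Longrightarrow> omap F x \<in> Obj D"
    and amap_in_Hom: "f \<in> Hom C x y \<Longrightarrow> amap F f \<in> Hom D (omap F x) (omap F y)"
    and amap_Ide: "x \<in> Obj C \<Longrightarrow> amap F (Ide C x) = Ide D (omap F x)"
    and amap_Comp: "f \<in> Hom C x y \<Longrightarrow> g \<in> Hom C y z \<Longrightarrow>
      amap F (Comp C g f) = Comp D (amap F g) (amap F f)"

definition func_comp ::
    "('p, 'b, 'q, 'c) func \<Rightarrow> ('o, 'a, 'p, 'b) func \<Rightarrow> ('o, 'a, 'q, 'c) func" where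
  "func_comp G F = \<lparr>omap = omap G \<circ> omap F, amap = amap G \<circ> amap F\<rparr>"

definition faithful :: "('o, 'a) cat \<Rightarrow> ('p, 'b) cat \<Rightarrow> ('o, 'a, 'p, 'b) func \<Rightarrow> bool" where
  "faithful C D F \<longleftrightarrow> (\<forall>x \<in> Obj C. \<forall>y \<in> Obj C. inj_on (amap F) (Hom C x y))"


section \<open>Colimits\<close>

definition cocone ::
    "('j, 'i) cat \<Rightarrow> ('o, 'a) cat \<Rightarrow> ('j, 'i, 'o, 'a) func \<Rightarrow> 'o \<Rightarrow> ('j \<Rightarrow> 'a) \<Rightarrow> bool" where
  "cocone J C D x t \<longleftrightarrow> x \<in> Obj C \<and>
     (\<forall>j \<in> Obj J. t j \<in> Hom C (omap D j) x) \<and>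
     (\<forall>u \<in> Arr J. Comp C (t (Cod J u)) (amap D u) = t (Dom J u))"

definition is_colimit ::
    "('j, 'i) cat \<Rightarrow> ('o, 'a) cat \<Rightarrow> ('j, 'i, 'o, 'a) func \<Rightarrow> 'o \<Rightarrow> ('j \<Rightarrow> 'a) \<Rightarrow> bool" where
  "is_colimit J C D x t \<longleftrightarrow> cocone J C D x t \<and>
     (\<forall>y s. cocone J C D y s \<longrightarrow>
        (\<exists>!h. h \<in> Hom C x y \<and> (\<forall>j \<in> Obj J. Comp C h (t j) = s j)))"

definition poset_cat :: "'i set \<Rightarrow> 'i rel \<Rightarrow> ('i, 'i \<times> 'i) cat" where
  "poset_cat I r = \<lparr>Obj = I, Arr = r, Dom = fst, Cod = snd,
     Ide = (\<lambda>i. (i, i)), Comp = (\<lambda>v u. (fst u, snd v))\<rparr>"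

definition directed_poset :: "'i set \<Rightarrow> 'i rel \<Rightarrow> bool" where
  "directed_poset I r \<longleftrightarrow> partial_order_on I r \<and> I \<noteq> {} \<and>
     (\<forall>i \<in> I. \<forall>j \<in> I. \<exists>k \<in> I. (i, k) \<in> r \<and> (j, k) \<in> r)"

definition has_directed_colimits :: "('u, 'u) cat \<Rightarrow> bool" where
  "has_directed_colimits C \<longleftrightarrow> (\<forall>(I :: 'u set) r D.
     small I \<and> directed_poset I r \<and> cat_functor (poset_cat I r) C D \<longrightarrow>
       (\<exists>x t. is_colimit (poset_cat I r) C D x t))"

text \<open>The first argument only fixes the universe from which the small index posets are taken.\<close>

definition preserves_directed_colimits ::
    "'u itself \<Rightarrow> ('o, 'a) cat \<Rightarrow> ('p, 'b) cat \<Rightarrow> ('o, 'a, 'p, 'b) func \<Rightarrow> bool" where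
  "preserves_directed_colimits _ C C' F \<longleftrightarrow> (\<forall>(I :: 'u set) r D x t.
     small I \<and> directed_poset I r \<and> cat_functor (poset_cat I r) C D \<and>
     is_colimit (poset_cat I r) C D x t \<longrightarrow>
       is_colimit (poset_cat I r) C' (func_comp F D) (omap F x) (amap F \<circ> t))"


section \<open>The categories of sets and of linear orders\<close>

text \<open>
  Arrows are triples (domain, function, codomain). Functions are extensional, i.e. they are
  \<^const>\<open>undefined\<close> off the domain, so that equality of arrows is equality of functions on it.
\<close>

definition SET :: "('u set, 'u set \<times> ('u \<Rightarrow> 'u) \<times> 'u set) cat" where
  "SET = \<lparr>Obj = {A. small A},
     Arr = {(A, f, B). small A \<and> small B \<and> f \<in> A \<rightarrow>\<^sub>E B},
     Dom = fst, Cod = snd \<circ> snd,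
     Ide = (\<lambda>A. (A, restrict id A, A)),
     Comp = (\<lambda>(_, g, C) (A, f, _). (A, compose A g f, C))\<rparr>"

type_synonym 'u linord = "'u set \<times> 'u rel"

definition Lin :: "('u linord, 'u linord \<times> ('u \<Rightarrow> 'u) \<times> 'u linord) cat" where
  "Lin = \<lparr>Obj = {(A, r). small A \<and> linear_order_on A r},
     Arr = {((A, r), f, (B, s)).
       small A \<and> linear_order_on A r \<and> small B \<and> linear_order_on B s \<and>
       f \<in> A \<rightarrow>\<^sub>E B \<and> inj_on f A \<and> (\<forall>(a, b) \<in> r. (f a, f b) \<in> s)},
     Dom = fst, Cod = snd \<circ> snd,
     Ide = (\<lambda>(A, r). ((A, r), restrict id A, (A, r))),
     Comp = (\<lambda>(_, g, Z) (X, f, _). (X, compose (fst X) g f, Z))\<rparr>"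


section \<open>Finitely accessible categories\<close>

definition locally_small :: "('u, 'u) cat \<Rightarrow> bool" where
  "locally_small C \<longleftrightarrow> (\<forall>x \<in> Obj C. \<forall>y \<in> Obj C. small (Hom C x y))"

definition hom_functor ::
    "('u, 'u) cat \<Rightarrow> 'u \<Rightarrow> ('u, 'u, 'u set, 'u set \<times> ('u \<Rightarrow> 'u) \<times> 'u set) func" where
  "hom_functor C x = \<lparr>omap = Hom C x,
     amap = (\<lambda>f. (Hom C x (Dom C f), \<lambda>g \<in> Hom C x (Dom C f). Comp C f g, Hom C x (Cod C f)))\<rparr>"

definition finitely_presentable :: "('u, 'u) cat \<Rightarrow> 'u \<Rightarrow> bool" where
  "finitely_presentable C x \<longleftrightarrow>
     x \<in> Obj C \<and> preserves_directed_colimits TYPE('u) C SET (hom_functor C x)"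

definition finitely_accessible :: "('u, 'u) cat \<Rightarrow> bool" where
  "finitely_accessible C \<longleftrightarrow> category C \<and> locally_small C \<and> has_directed_colimits C \<and>
     (\<exists>\<A>. small \<A> \<and> (\<forall>a \<in> \<A>. finitely_presentable C a) \<and>
        (\<forall>x \<in> Obj C. \<exists>(I :: 'u set) r D t.
           small I \<and> directed_poset I r \<and> cat_functor (poset_cat I r) C D \<and>
           (\<forall>i \<in> I. omap D i \<in> \<A>) \<and> is_colimit (poset_cat I r) C D x t))"

definition large :: "('u, 'u) cat \<Rightarrow> bool" where
  "large C \<longleftrightarrow> \<not> (\<exists>S \<subseteq> Obj C. small S \<and> (\<forall>x \<in> Obj C. \<exists>y \<in> S. isomorphic C x y))"


section \<open>The constructions above are categories and functors\<close>

lemma category_poset_cat: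
  assumes "partial_order_on I r"
  shows "category (poset_cat I r)"
proof -
  have r: "r \<subseteq> I \<times> I" "\<forall>i\<in>I. (i, i) \<in> r" "trans r"
    using partial_order_onD[OF assms] by (simp_all add: refl_on_def)
  show ?thesis
  proof unfold_locales
    fix x y z f g assume "f \<in> Hom (poset_cat I r) x y" "g \<in> Hom (poset_cat I r) y z"
    then have "(x, y) \<in> r" "(y, z) \<in> r" "fst f = x" "snd g = z"
      by (cases f, cases g, auto simp: poset_cat_def Hom_def)+
    moreover from this have "(x, z) \<in> r" using transD[OF r(3)] by blast
    ultimately show "Comp (poset_cat I r) g f \<in> Hom (poset_cat I r) x z"
      by (simp add: poset_cat_def Hom_def)
  qed (use r(1,2) in \<open>auto simp: poset_cat_def Hom_def\<close>)
qed

lemma compose_restrict_id: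
  assumes "f \<in> A \<rightarrow>\<^sub>E B"
  shows "compose A f (restrict id A) = f"
  using PiE_arb[OF assms] by (auto simp: compose_def)

lemma restrict_id_compose:
  assumes "f \<in> A \<rightarrow>\<^sub>E B"
  shows "compose A (restrict id B) f = f"
  using PiE_arb[OF assms] PiE_mem[OF assms] by (auto simp: compose_def)

lemma compose_compose:
  assumes "f \<in> A \<rightarrow>\<^sub>E B"
  shows "compose A (compose B h g) f = compose A h (compose A g f)"
  using PiE_mem[OF assms] by (auto simp: compose_def)

lemmas compose_PiE = compose_restrict_id restrict_id_compose compose_compose

lemma category_SET: "category SET"
  by unfold_locales (auto simp: SET_def Hom_def compose_PiE, auto simp: compose_def)

lemma inj_on_compose_PiE:
  assumes "f \<in> A \<rightarrow>\<^sub>E B" "inj_on f A" "inj_on g B"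
  shows "inj_on (compose A g f) A"
proof (rule inj_onI)
  fix x y assume xy: "x \<in> A" "y \<in> A" "compose A g f x = compose A g f y"
  then have "g (f x) = g (f y)" by (simp add: compose_def)
  with assms xy have "f x = f y" by (auto dest: inj_onD)
  with assms xy show "x = y" by (auto dest: inj_onD)
qed

lemma linear_order_onD:
  "linear_order_on A r \<Longrightarrow> (a, b) \<in> r \<Longrightarrow> a \<in> A \<and> b \<in> A"
  by (auto simp: order_on_defs)

lemma category_Lin: "category Lin"
proof unfold_locales
  fix X Y Z :: "'a linord" and f g
  assume "f \<in> Hom Lin X Y" "g \<in> Hom Lin Y Z"
  then show "Comp Lin g f \<in> Hom Lin X Z"
    by (auto simp: Lin_def Hom_def inj_on_compose_PiE)
      (auto simp: compose_def dest: linear_order_onD)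
qed (auto simp: Lin_def Hom_def compose_PiE dest: linear_order_onD)

lemma cat_functor_hom_functor:
  assumes "category C" "locally_small C" "x \<in> Obj C"
  shows "cat_functor C SET (hom_functor C x)"
proof -
  interpret category C by fact
  interpret S: category SET by (rule category_SET)
  show ?thesis
  proof
    fix y assume "y \<in> Obj C"
    then show "omap (hom_functor C x) y \<in> Obj SET"
      using assms by (simp add: hom_functor_def SET_def locally_small_def)
  next
    fix f y z assume "f \<in> Hom C y z"
    moreover from this have "y \<in> Obj C" "z \<in> Obj C"
      using Dom_in_Obj Cod_in_Obj by (auto simp: Hom_def)
    moreover from calculation have "Dom C f = y" "Cod C f = z" by (auto simp: Hom_def)
    ultimately show "amap (hom_functor C x) f
        \<in> Hom SET (omap (hom_functor C x) y) (omap (hom_functor C x) z)"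
      using assms Comp_in_Hom unfolding Hom_def[of SET]
      by (auto simp: hom_functor_def SET_def locally_small_def)
  next
    fix y assume "y \<in> Obj C"
    moreover from Ide_in_Hom[OF this] have "Dom C (Ide C y) = y" "Cod C (Ide C y) = y"
      by (auto simp: Hom_def)
    ultimately show "amap (hom_functor C x) (Ide C y) = Ide SET (omap (hom_functor C x) y)"
      using Ide_Comp by (auto simp: hom_functor_def SET_def restrict_def fun_eq_iff)
  next
    fix f g y z w assume *: "f \<in> Hom C y z" "g \<in> Hom C z w"
    have "Comp C g f \<in> Hom C y w" using * Comp_in_Hom by blast
    then have "Dom C f = y" "Cod C f = z" "Dom C g = z" "Cod C g = w"
        "Dom C (Comp C g f) = y" "Cod C (Comp C g f) = w"
      using * by (auto simp: Hom_def)
    then show "amap (hom_functor C x) (Comp C g f)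
        = Comp SET (amap (hom_functor C x) g) (amap (hom_functor C x) f)"
      using * Comp_assoc Comp_in_Hom
      by (auto simp: hom_functor_def SET_def compose_def restrict_def fun_eq_iff)
  qed
qed

end

theory Submission
  imports Defs
begin

text \<open>
  A functor on \<open>Lin\<close> that preserves directed colimits is determined by its values on finite linear
  orders, since every linear order is the directed union of its finite subsets; conversely any
  functor from finite linear orders and embeddings to \<open>K\<close> extends to \<open>Lin\<close> by taking directed
  colimits over finite subsets. The task is thus to find a diagram in \<open>K\<close> over the finite linear
  orders for which distinct points remain distinct. The idea is that of Ehrenfeucht and
  Mostowski: extract the diagram from indiscernible elements of large objects.

  Let \<open>\<A>\<close> be a small set of finitely presentable objects which generates \<open>K\<close>. Since \<open>K\<close> is large,
  the sets \<open>Hom(a, M)\<close> with \<open>a \<in> \<A>\<close> are arbitrarily large (\<open>large_Hom\<close>): otherwise there would be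
  only a small set of presheaves \<open>Hom(-, M)\<close> on \<open>\<A>\<close>, and these determine \<open>M\<close> up to isomorphism.
  Write \<open>M\<close> as a directed colimit of objects of \<open>\<A>\<close> and send, monotonically, every finite
  set \<open>s\<close> of elements of \<open>Hom(a, M)\<close> to an index at which all of them are represented. This gives
  a functor from the finite subsets of \<open>Hom(a, M)\<close> to \<open>\<A>\<close> (\<open>realization_of_Hom\<close>); choosing its
  values plays the role of Skolem functions.

  The part of this functor below a finite set \<open>s\<close> is a finite amount of data in the small set of
  arrows of \<open>\<A>\<close>, so it is a colouring of finite sets by small sets of colours. The Erdos-Rado theorem,
  applied once for each cardinality with a pigeonhole argument in between, yields one colour for
  each cardinality such that arbitrarily large finite sets with all their subsets coloured in
  this way exist (\<open>coherent_colours\<close>). There need not be a single infinite homogeneous set, but none is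
  required: functoriality of a diagram over finite linear orders concerns only finitely
  many points at a time. So the colours form a functor on the finite linear orders
  (\<open>order_invariant_diagram_exists\<close>), and it separates points because different elements of \<open>Hom(a, M)\<close>
  are never identified at any stage.

  The extension to \<open>Lin\<close> is faithful since the value at one point is finitely presentable, so that
  an identification of two points in the colimit would already happen on a finite subset. It
  preserves directed colimits since in \<open>Lin\<close> they are directed unions of the images, whence each
  finite subset of the colimit lifts to a finite subset of some stage.
\<close>

section \<open>Small sets over an arbitrary type\<close>

text \<open>
  Families of finite subsets, sets of colours and sets of codes do not live over the type \<open>'u\<close> of
  the universe, which therefore becomes a parameter.
\<close>

definition small_for :: "'u itself \<Rightarrow> 'b set \<Rightarrow> bool" where
  "small_for _ B \<longleftrightarrow> |B| <o |UNIV :: 'u set|"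

lemma small_for_small: "small_for TYPE('u) A \<longleftrightarrow> small (A :: 'u set)"
  by (simp add: small_for_def small_def)

lemma small_for_ordLeq: "small_for TYPE('u) B \<Longrightarrow> |A| \<le>o |B| \<Longrightarrow> small_for TYPE('u) A"
  unfolding small_for_def using ordLeq_ordLess_trans by blast

lemma small_for_subset: "small_for TYPE('u) B \<Longrightarrow> A \<subseteq> B \<Longrightarrow> small_for TYPE('u) A"
  by (meson small_for_ordLeq card_of_mono1)

lemma small_for_image: "small_for TYPE('u) B \<Longrightarrow> small_for TYPE('u) (f ` B)"
  by (meson small_for_ordLeq card_of_image)

lemma small_for_inj: "inj_on f A \<Longrightarrow> f ` A \<subseteq> B \<Longrightarrow> small_for TYPE('u) B \<Longrightarrow> small_for TYPE('u) A"
  by (meson small_for_ordLeq card_of_ordLeq)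

lemma small_for_representative:
  assumes "small_for TYPE('u) (B :: 'b set)"
  obtains S :: "'u set" and f where "small S" "bij_betw f B S"
proof -
  have "|B| \<le>o |UNIV :: 'u set|"
    using assms unfolding small_for_def by (rule ordLess_imp_ordLeq)
  then obtain f :: "'b \<Rightarrow> 'u" where f: "inj_on f B"
    using card_of_ordLeq by metis
  have "small (f ` B)"
    using small_for_image[OF assms, of f] by (simp add: small_for_small)
  then show thesis using f that by (auto simp: bij_betw_def)
qed

lemma ordLeq_total: "|A| \<le>o |B| \<or> |B| <o |A|"
  by (metis card_of_Well_order not_ordLess_iff_ordLeq)

context
  assumes inacc: "inaccessible |UNIV :: 'u set|"
begin

lemma infinite_universe: "infinite (UNIV :: 'u set)"
proof -
  have "natLeq \<le>o |UNIV :: 'u set|"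
    using inacc ordLess_imp_ordLeq by (auto simp: inaccessible_def)
  then show ?thesis using infinite_iff_natLeq_ordLeq by blast
qed

lemma small_for_finite: "finite B \<Longrightarrow> small_for TYPE('u) B"
  unfolding small_for_def using infinite_universe
  by (meson card_of_Well_order card_of_ordLeq_finite not_ordLess_iff_ordLeq)

lemma small_for_Sigma:
  assumes "small_for TYPE('u) A" "\<And>a. a \<in> A \<Longrightarrow> small_for TYPE('u) (B a)"
  shows "small_for TYPE('u) (SIGMA a:A. B a)"
proof -
  have "stable |UNIV :: 'u set|"
    using inacc infinite_universe
    by (intro regularCard_stable) (auto simp: inaccessible_def Field_card_of)
  then show ?thesis using assms unfolding small_for_def by (intro stable_elim) auto
qed

lemma small_for_Times:
  "small_for TYPE('u) A \<Longrightarrow> small_for TYPE('u) B \<Longrightarrow> small_for TYPE('u) (A \<times> B)"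
  by (rule small_for_Sigma)

lemma small_for_UN:
  assumes "small_for TYPE('u) A" "\<And>a. a \<in> A \<Longrightarrow> small_for TYPE('u) (B a)"
  shows "small_for TYPE('u) (\<Union>a\<in>A. B a)"
proof -
  have "(\<Union>a\<in>A. B a) = snd ` (SIGMA a:A. B a)" by force
  moreover have "small_for TYPE('u) (snd ` (SIGMA a:A. B a))"
    using assms by (intro small_for_image small_for_Sigma)
  ultimately show ?thesis by simp
qed

lemma small_for_Pow:
  assumes "small_for TYPE('u) A"
  shows "small_for TYPE('u) (Pow A)"
proof -
  obtain S :: "'u set" and f where S: "small S" "bij_betw f A S"
    using small_for_representative[OF assms] .
  have "|Pow S| <o |UNIV :: 'u set|"
    using inacc S(1) by (auto simp: inaccessible_def small_def)
  moreover have "bij_betw (image f) (Pow A) (Pow S)"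
    using S(2) by (rule bij_betw_Pow)
  ultimately show ?thesis
    by (intro small_for_inj[of "image f" "Pow A" "Pow S"]) (auto simp: bij_betw_def small_for_def)
qed

lemma small_for_PiE:
  assumes "small_for TYPE('u) A" "small_for TYPE('u) B"
  shows "small_for TYPE('u) (A \<rightarrow>\<^sub>E B)"
proof (rule small_for_inj)
  show "inj_on (\<lambda>f. {(x, f x) |x. x \<in> A}) (A \<rightarrow>\<^sub>E B)"
  proof (rule inj_onI)
    fix f g assume *: "f \<in> A \<rightarrow>\<^sub>E B" "g \<in> A \<rightarrow>\<^sub>E B" "{(x, f x) |x. x \<in> A} = {(x, g x) |x. x \<in> A}"
    have "f x = g x" if "x \<in> A" for x using *(3) that by auto
    then show "f = g" using * by (intro PiE_ext)
  qed
  show "(\<lambda>f. {(x, f x) |x. x \<in> A}) ` (A \<rightarrow>\<^sub>E B) \<subseteq> Pow (A \<times> B)" by auto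
  show "small_for TYPE('u) (Pow (A \<times> B))"
    using assms by (intro small_for_Pow small_for_Times)
qed

text \<open>
  Cantor's theorem supplies a small cardinal that is strictly larger than a given one.
\<close>

lemma small_for_exceeded:
  assumes "small_for TYPE('u) B"
  obtains S :: "'u set" where "small S" "\<not> |S| \<le>o |B|"
proof -
  obtain S :: "'u set" and f where S: "small S" "bij_betw f (Pow B) S"
    using small_for_representative[OF small_for_Pow[OF assms]] .
  have "\<not> |S| \<le>o |B|"
  proof
    assume "|S| \<le>o |B|"
    moreover have "|Pow B| =o |S|" using S(2) card_of_ordIso by blast
    ultimately have "|Pow B| \<le>o |B|" using ordIso_ordLeq_trans by blast
    then show False using card_of_Pow[of B] not_ordLess_ordLeq by blast
  qed
  then show thesis using S(1) that by blast
qed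


section \<open>Partition calculus\<close>

text \<open>
  For each \<open>x\<close> in \<open>X\<close>, a sequence \<open>z x\<close> indexed by a well-ordering of \<open>S\<close> is built by recursion: its
  next member is a point that is new and that the colours cannot tell apart from \<open>x\<close> over the
  members already chosen. As long as \<open>x\<close> itself has not been chosen, \<open>x\<close> is a candidate. If some
  sequence never reaches \<open>x\<close>, its range \<open>Y\<close> is as required, because in any finite subset of \<open>Y\<close> the
  member chosen last can be exchanged for \<open>x\<close>. If every sequence reaches its \<open>x\<close>, then \<open>x\<close> can be
  recovered from the stage at which this happens and the colours used up to that stage, so that
  \<open>X\<close> injects into \<open>S \<times> Pow (Pow S \<times> T)\<close>.
\<close>

lemma end_homogeneous_subset:
  fixes S :: "'u set" and T :: "'c set" and X :: "'x set" and c :: "'x set \<Rightarrow> 'c"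
  assumes big: "\<not> |X| \<le>o |S \<times> Pow (Pow S \<times> T)|"
    and colours: "\<And>s. s \<subseteq> X \<Longrightarrow> finite s \<Longrightarrow> card s = Suc n \<Longrightarrow> c s \<in> T"
  obtains Y x where "Y \<subseteq> X" "x \<in> X" "x \<notin> Y" "|S| \<le>o |Y|"
    "\<And>s. s \<subseteq> Y \<Longrightarrow> finite s \<Longrightarrow> card s = Suc n \<Longrightarrow>
       \<exists>t\<subseteq>s. card t = n \<and> c s = c (insert x t)"
proof -
  define R where "R = |S| - Id"
  have wo: "well_order_on S |S|" by (rule card_of_well_order_on)
  then have wfR: "wf R" by (simp add: R_def well_order_on_def)
  have R_total: "(\<alpha>, \<beta>) \<in> R \<or> (\<beta>, \<alpha>) \<in> R" if "\<alpha> \<in> S" "\<beta> \<in> S" "\<alpha> \<noteq> \<beta>" for \<alpha> \<beta>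
    using wo that by (auto simp: R_def well_order_on_def linear_order_on_def total_on_def)
  have R_S: "\<alpha> \<in> S \<and> \<beta> \<in> S" if "(\<alpha>, \<beta>) \<in> R" for \<alpha> \<beta>
    using that wo by (auto simp: R_def dest: well_order_on_domain)
  have R_trans: "trans R"
    using wo unfolding R_def well_order_on_def linear_order_on_def partial_order_on_def preorder_on_def
    by (blast intro: trans_diff_Id)
  have R_irrefl: "(\<alpha>, \<alpha>) \<notin> R" for \<alpha> by (simp add: R_def)
  let ?below = "\<lambda>\<alpha>. {\<beta>. (\<beta>, \<alpha>) \<in> R}"
  \<comment> \<open>The candidates at stage \<open>\<alpha>\<close> look like \<open>x\<close> over everything chosen at the earlier stages.\<close>
  define cand where "cand x f \<alpha> = {y \<in> X. y \<notin> f ` ?below \<alpha> \<and>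
      (\<forall>\<tau>\<subseteq>?below \<alpha>. finite \<tau> \<longrightarrow> card \<tau> = n \<longrightarrow>
         c (insert y (f ` \<tau>)) = c (insert x (f ` \<tau>)))}" for x f \<alpha>
  define z where "z x = wfrec R (\<lambda>f \<alpha>. SOME y. y \<in> cand x f \<alpha>)" for x
  have cand_cong: "cand x f \<alpha> = cand x g \<alpha>" if "\<And>\<beta>. (\<beta>, \<alpha>) \<in> R \<Longrightarrow> f \<beta> = g \<beta>" for x f g \<alpha>
  proof -
    have "f ` \<tau> = g ` \<tau>" if "\<tau> \<subseteq> ?below \<alpha>" for \<tau>
      using that \<open>\<And>\<beta>. (\<beta>, \<alpha>) \<in> R \<Longrightarrow> f \<beta> = g \<beta>\<close> by (intro image_cong) auto
    then show ?thesis unfolding cand_def by (intro Collect_cong) auto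
  qed
  have z: "z x \<alpha> = (SOME y. y \<in> cand x (z x) \<alpha>)" for x \<alpha>
  proof -
    have "z x \<alpha> = (SOME y. y \<in> cand x (cut (z x) R \<alpha>) \<alpha>)"
      unfolding z_def by (subst wfrec[OF wfR]) simp
    also have "cand x (cut (z x) R \<alpha>) \<alpha> = cand x (z x) \<alpha>"
      by (rule cand_cong) (simp add: cut_apply)
    finally show ?thesis .
  qed
  have z_cand: "z x \<alpha> \<in> cand x (z x) \<alpha>" if "x \<in> X" "x \<notin> z x ` ?below \<alpha>" for x \<alpha>
  proof -
    have "x \<in> cand x (z x) \<alpha>" using that by (simp add: cand_def)
    then show ?thesis unfolding z[of x \<alpha>] by (rule someI)
  qed
  have "\<exists>x\<in>X. x \<notin> z x ` S"
  proof (rule ccontr)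
    assume "\<not> ?thesis"
    then have hit: "\<exists>\<alpha>\<in>S. z x \<alpha> = x" if "x \<in> X" for x using that by (metis imageE)
    have "\<exists>\<alpha>. \<alpha> \<in> S \<and> z x \<alpha> = x \<and> (\<forall>\<beta>. (\<beta>, \<alpha>) \<in> R \<longrightarrow> z x \<beta> \<noteq> x)" if "x \<in> X" for x
    proof -
      have "{\<alpha> \<in> S. z x \<alpha> = x} \<noteq> {}" using hit[OF that] by auto
      then obtain \<alpha> where "\<alpha> \<in> {\<alpha> \<in> S. z x \<alpha> = x}" "\<And>\<beta>. (\<beta>, \<alpha>) \<in> R \<Longrightarrow> \<beta> \<notin> {\<alpha> \<in> S. z x \<alpha> = x}"
        using wfE_min'[OF wfR, of "{\<alpha> \<in> S. z x \<alpha> = x}"] by blast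
      then show ?thesis using R_S by blast
    qed
    then obtain h where h: "\<And>x. x \<in> X \<Longrightarrow> h x \<in> S" "\<And>x. x \<in> X \<Longrightarrow> z x (h x) = x"
      "\<And>x \<beta>. x \<in> X \<Longrightarrow> (\<beta>, h x) \<in> R \<Longrightarrow> z x \<beta> \<noteq> x" by metis
    \<comment> \<open>A point is recovered from the stage at which it is reached and from the colours which
      it determines over the earlier stages, since these data determine the whole recursion.\<close>
    define pat where "pat x = {(\<tau>, c (insert x (z x ` \<tau>))) |\<tau>.
      \<tau> \<subseteq> ?below (h x) \<and> finite \<tau> \<and> card \<tau> = n}" for x
    have z_X: "z x \<beta> \<in> cand x (z x) \<beta>" if "x \<in> X" "\<beta> = h x \<or> (\<beta>, h x) \<in> R" for x \<beta>
    proof (rule z_cand[OF that(1)])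
      show "x \<notin> z x ` ?below \<beta>"
        using h(3)[OF that(1)] that(2) transD[OF R_trans] by fastforce
    qed
    have z_inj: "inj_on (z x) (?below (h x))" if "x \<in> X" for x
    proof (rule inj_onI, rule ccontr)
      fix \<alpha> \<beta> assume *: "\<alpha> \<in> ?below (h x)" "\<beta> \<in> ?below (h x)" "z x \<alpha> = z x \<beta>" "\<alpha> \<noteq> \<beta>"
      then have "(\<alpha>, \<beta>) \<in> R \<or> (\<beta>, \<alpha>) \<in> R" using R_total R_S by blast
      then show False using * z_X[OF that] unfolding cand_def
        by (metis (no_types, lifting) image_eqI mem_Collect_eq)
    qed
    have "inj_on (\<lambda>x. (h x, pat x)) X"
    proof (rule inj_onI)
      fix x y assume xy: "x \<in> X" "y \<in> X" "(h x, pat x) = (h y, pat y)"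
      have "z x \<beta> = z y \<beta>" if "\<beta> = h x \<or> (\<beta>, h x) \<in> R" for \<beta>
        using wfR that
      proof (induction \<beta> rule: wf_induct_rule)
        case (less \<beta>)
        have below: "\<gamma> \<in> ?below (h x)" if "\<gamma> \<in> ?below \<beta>" for \<gamma>
          using that less.prems transD[OF R_trans] by blast
        have eq: "z x \<gamma> = z y \<gamma>" if "\<gamma> \<in> ?below \<beta>" for \<gamma>
          using less.IH[of \<gamma>] below[OF that] that by auto
        have im: "z x ` \<tau> = z y ` \<tau>" if "\<tau> \<subseteq> ?below \<beta>" for \<tau>
          using eq that by (intro image_cong) auto
        have col: "c (insert x (z x ` \<tau>)) = c (insert y (z y ` \<tau>))"
          if "\<tau> \<subseteq> ?below \<beta>" "finite \<tau>" "card \<tau> = n" for \<tau>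
        proof -
          have "(\<tau>, c (insert x (z x ` \<tau>))) \<in> pat x"
            using that below unfolding pat_def by blast
          then show ?thesis using xy(3) unfolding pat_def by auto
        qed
        have "cand x (z x) \<beta> = cand y (z y) \<beta>"
          unfolding cand_def using im[OF subset_refl] im col by (intro Collect_cong) metis
        then show ?case using z by metis
      qed
      then show "x = y" using h(2) xy by (metis Pair_inject)
    qed
    moreover have "(\<lambda>x. (h x, pat x)) ` X \<subseteq> S \<times> Pow (Pow S \<times> T)"
    proof -
      have "c (insert x (z x ` \<tau>)) \<in> T"
        if "x \<in> X" "\<tau> \<subseteq> ?below (h x)" "finite \<tau>" "card \<tau> = n" for x \<tau>
      proof (rule colours)
        have "z x ` \<tau> \<subseteq> X" using z_X[OF that(1)] that(2) by (auto simp: cand_def)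
        then show "insert x (z x ` \<tau>) \<subseteq> X" using that by blast
        have "inj_on (z x) \<tau>" using z_inj[OF that(1)] that(2) inj_on_subset by blast
        then have "card (z x ` \<tau>) = n" using that(4) by (simp add: card_image)
        moreover have "x \<notin> z x ` \<tau>" using h(3)[OF that(1)] that(2) by (metis imageE mem_Collect_eq subsetD)
        ultimately show "card (insert x (z x ` \<tau>)) = Suc n" using that(3) by simp
      qed (use that in simp)
      then show ?thesis using h(1) R_S unfolding pat_def by auto
    qed
    ultimately show False using big card_of_ordLeq by blast
  qed
  then obtain x where x: "x \<in> X" "x \<notin> z x ` S" by blast
  have zx: "z x \<alpha> \<in> cand x (z x) \<alpha>" if "\<alpha> \<in> S" for \<alpha>
    using x R_S by (intro z_cand) auto
  have inj: "inj_on (z x) S"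
  proof (rule inj_onI, rule ccontr)
    fix \<alpha> \<beta> assume *: "\<alpha> \<in> S" "\<beta> \<in> S" "z x \<alpha> = z x \<beta>" "\<alpha> \<noteq> \<beta>"
    then have "(\<alpha>, \<beta>) \<in> R \<or> (\<beta>, \<alpha>) \<in> R" using R_total by blast
    then show False using * zx unfolding cand_def
      by (metis (no_types, lifting) image_eqI mem_Collect_eq)
  qed
  show thesis
  proof (rule that[of "z x ` S" x])
    show "z x ` S \<subseteq> X" using zx by (auto simp: cand_def)
    show "|S| \<le>o |z x ` S|" using inj card_of_ordLeq by blast
    fix s assume s: "s \<subseteq> z x ` S" "finite s" "card s = Suc n"
    then obtain \<sigma> where \<sigma>: "\<sigma> \<subseteq> S" "s = z x ` \<sigma>" by (meson subset_imageE)
    have inj\<sigma>: "inj_on (z x) \<sigma>" using inj \<sigma>(1) inj_on_subset by blast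
    then have fin: "finite \<sigma>" and card\<sigma>: "card \<sigma> = Suc n"
      using s \<sigma> by (auto simp: card_image finite_image_iff)
    have "\<exists>\<alpha>\<in>\<sigma>. \<forall>\<beta>\<in>\<sigma>. \<beta> \<noteq> \<alpha> \<longrightarrow> (\<beta>, \<alpha>) \<in> R"
    proof -
      \<comment> \<open>the largest stage occurring in \<open>s\<close>\<close>
      have "wf ((R\<inverse>) \<inter> \<sigma> \<times> \<sigma>)"
      proof (rule finite_acyclic_wf)
        have "trans (R\<inverse> \<inter> \<sigma> \<times> \<sigma>)" using R_trans by (auto simp: trans_def)
        then show "acyclic (R\<inverse> \<inter> \<sigma> \<times> \<sigma>)" using R_irrefl by (simp add: acyclic_def trancl_id)
      qed (use fin in simp)
      moreover have "\<sigma> \<noteq> {}" using card\<sigma> by auto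
      ultimately obtain \<alpha> where "\<alpha> \<in> \<sigma>" "\<And>\<beta>. (\<beta>, \<alpha>) \<in> R\<inverse> \<inter> \<sigma> \<times> \<sigma> \<Longrightarrow> \<beta> \<notin> \<sigma>"
        using wfE_min' by metis
      then show ?thesis using R_total \<sigma>(1) by blast
    qed
    then obtain \<alpha> where \<alpha>: "\<alpha> \<in> \<sigma>" "\<sigma> - {\<alpha>} \<subseteq> ?below \<alpha>" by blast
    have "card (\<sigma> - {\<alpha>}) = n" using card\<sigma> \<alpha>(1) fin by simp
    then have "c (insert (z x \<alpha>) (z x ` (\<sigma> - {\<alpha>}))) = c (insert x (z x ` (\<sigma> - {\<alpha>})))"
      using zx \<alpha> \<sigma>(1) fin unfolding cand_def by blast
    moreover have "insert (z x \<alpha>) (z x ` (\<sigma> - {\<alpha>})) = s" using \<alpha>(1) \<sigma>(2) by blast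
    moreover have "card (z x ` (\<sigma> - {\<alpha>})) = n"
      using inj\<sigma> \<open>card (\<sigma> - {\<alpha>}) = n\<close> by (metis card_image inj_on_diff)
    ultimately show "\<exists>t\<subseteq>s. card t = n \<and> c s = c (insert x t)"
      using \<sigma>(2) by (metis Diff_subset image_mono)
  qed (use x in auto)
qed

text \<open>
  The Erdos-Rado partition theorem without its explicit bound: what matters is that \<open>S'\<close> depends on
  \<open>S\<close>, \<open>T\<close> and \<open>n\<close> only. On an end-homogeneous set the colour of an \<open>n + 1\<close>-subset is that of
  \<open>insert x t\<close> for an \<open>n\<close>-subset \<open>t\<close>, which lowers the cardinality of the coloured sets by one.
\<close>

lemma Erdos_Rado:
  fixes S :: "'u set" and T :: "'c set"
  assumes "small S" "small_for TYPE('u) T"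
  shows "\<exists>S' :: 'u set. small S' \<and> (\<forall>(X :: 'x set) c. |S'| \<le>o |X| \<longrightarrow>
    (\<forall>s\<subseteq>X. finite s \<longrightarrow> card s = n \<longrightarrow> c s \<in> T) \<longrightarrow>
    (\<exists>Y\<subseteq>X. |S| \<le>o |Y| \<and> (\<exists>q. \<forall>s\<subseteq>Y. finite s \<longrightarrow> card s = n \<longrightarrow> c s = q)))"
proof (induction n)
  case 0
  show ?case
  proof (intro exI[of _ S] conjI allI impI)
    fix X :: "'x set" and c :: "'x set \<Rightarrow> 'c" assume "|S| \<le>o |X|"
    moreover have "\<forall>s\<subseteq>X. finite s \<longrightarrow> card s = 0 \<longrightarrow> c s = c {}" by auto
    ultimately show "\<exists>Y\<subseteq>X. |S| \<le>o |Y| \<and> (\<exists>q. \<forall>s\<subseteq>Y. finite s \<longrightarrow> card s = 0 \<longrightarrow> c s = q)"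
      by blast
  qed (rule assms)
next
  case (Suc n)
  then obtain S1 :: "'u set" where S1: "small S1"
    "\<And>(X :: 'x set) c. |S1| \<le>o |X| \<Longrightarrow> \<forall>s\<subseteq>X. finite s \<longrightarrow> card s = n \<longrightarrow> c s \<in> T \<Longrightarrow>
      \<exists>Y\<subseteq>X. |S| \<le>o |Y| \<and> (\<exists>q. \<forall>s\<subseteq>Y. finite s \<longrightarrow> card s = n \<longrightarrow> c s = q)" by blast
  have "small_for TYPE('u) (S1 \<times> Pow (Pow S1 \<times> T))"
    using S1(1) assms(2) by (intro small_for_Times small_for_Pow) (auto simp: small_for_small)
  then obtain S' :: "'u set" where S': "small S'" "\<not> |S'| \<le>o |S1 \<times> Pow (Pow S1 \<times> T)|"
    by (rule small_for_exceeded)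
  show ?case
  proof (intro exI[of _ S'] conjI allI impI)
    fix X :: "'x set" and c :: "'x set \<Rightarrow> 'c"
    assume X: "|S'| \<le>o |X|" and c: "\<forall>s\<subseteq>X. finite s \<longrightarrow> card s = Suc n \<longrightarrow> c s \<in> T"
    have "\<not> |X| \<le>o |S1 \<times> Pow (Pow S1 \<times> T)|" using X S'(2) ordLeq_transitive by blast
    then obtain Z x where Z: "Z \<subseteq> X" "x \<in> X" "x \<notin> Z" "|S1| \<le>o |Z|"
      "\<And>s. s \<subseteq> Z \<Longrightarrow> finite s \<Longrightarrow> card s = Suc n \<Longrightarrow>
         \<exists>t\<subseteq>s. card t = n \<and> c s = c (insert x t)"
      using end_homogeneous_subset[of X S1 T n c] c by metis
    have "\<forall>s\<subseteq>Z. finite s \<longrightarrow> card s = n \<longrightarrow> c (insert x s) \<in> T"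
    proof (intro allI impI)
      fix s assume s: "s \<subseteq> Z" "finite s" "card s = n"
      then have "card (insert x s) = Suc n" using Z(3) by (metis card_insert_disjoint subsetD)
      then show "c (insert x s) \<in> T" using c s Z(1,2) by (metis finite.insertI insert_subset subset_trans)
    qed
    from S1(2)[OF Z(4) this] obtain Y q where Y: "Y \<subseteq> Z" "|S| \<le>o |Y|"
      "\<And>s. s \<subseteq> Y \<Longrightarrow> finite s \<Longrightarrow> card s = n \<Longrightarrow> c (insert x s) = q" by blast
    have "c s = q" if s: "s \<subseteq> Y" "finite s" "card s = Suc n" for s
    proof -
      obtain t where "t \<subseteq> s" "card t = n" "c s = c (insert x t)"
        using Z(5)[OF subset_trans[OF s(1) Y(1)] s(2,3)] by blast
      then show ?thesis using Y(3)[of t] s by (metis finite_subset subset_trans)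
    qed
    then show "\<exists>Y\<subseteq>X. |S| \<le>o |Y| \<and> (\<exists>q. \<forall>s\<subseteq>Y. finite s \<longrightarrow> card s = Suc n \<longrightarrow> c s = q)"
      using Y(1,2) Z(1) by blast
  qed (rule S')
qed

text \<open>
  The colours are fixed for one cardinality after another while the family of available coloured
  sets stays unbounded in size. At stage \<open>n\<close>, the partition theorem makes arbitrarily large sets
  homogeneous for \<open>n\<close>-subsets, though the colour may depend on the size asked for. As there
  are few colours, one of them works for all sizes: if each colour \<open>q\<close> failed for some set \<open>B q\<close>,
  the union of all the \<open>B q\<close> would contradict the partition theorem.
\<close>

lemma coherent_colours:
  fixes R :: "('x set \<times> ('x set \<Rightarrow> 'c)) set" and T :: "nat \<Rightarrow> 'c set"
  assumes small_T: "\<And>n. small_for TYPE('u) (T n)"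
    and colours: "\<And>X c s. (X, c) \<in> R \<Longrightarrow> s \<subseteq> X \<Longrightarrow> finite s \<Longrightarrow> c s \<in> T (card s)"
    and unbounded: "\<And>S :: 'u set. small S \<Longrightarrow> \<exists>(X, c)\<in>R. |S| \<le>o |X|"
  obtains p where "\<And>n. \<exists>(X, c)\<in>R. \<exists>s\<subseteq>X. finite s \<and> card s = n \<and> (\<forall>s'\<subseteq>s. c s' = p (card s'))"
proof -
  define hom where "hom n p S \<longleftrightarrow> (\<exists>(X, c)\<in>R. \<exists>Y\<subseteq>X. |S| \<le>o |Y| \<and>
      (\<forall>s\<subseteq>Y. finite s \<longrightarrow> card s < n \<longrightarrow> c s = p (card s)))" for n p and S :: "'u set"
  have step: "\<exists>q. (\<forall>k<n. q k = p k) \<and> (\<forall>S. small S \<longrightarrow> hom (Suc n) q S)"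
    if p: "\<forall>S. small S \<longrightarrow> hom n p S" for n p
  proof -
    \<comment> \<open>For infinite \<open>S\<close> the homogeneous set has an \<open>n\<close>-subset, whose colour shows \<open>q \<in> T n\<close>.\<close>
    have *: "\<exists>q\<in>T n. hom (Suc n) (p(n := q)) S" if "small S" and S: "infinite S" for S
    proof -
      obtain S' :: "'u set" where S': "small S'"
        "\<And>(X :: 'x set) c. |S'| \<le>o |X| \<Longrightarrow> \<forall>s\<subseteq>X. finite s \<longrightarrow> card s = n \<longrightarrow> c s \<in> T n \<Longrightarrow>
           \<exists>Y\<subseteq>X. |S| \<le>o |Y| \<and> (\<exists>q. \<forall>s\<subseteq>Y. finite s \<longrightarrow> card s = n \<longrightarrow> c s = q)"
        using Erdos_Rado[OF \<open>small S\<close> small_T[of n], of n] by blast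
      from p S'(1) have "hom n p S'" by blast
      then obtain X c Y where Y: "(X, c) \<in> R" "Y \<subseteq> X" "|S'| \<le>o |Y|"
        "\<And>s. s \<subseteq> Y \<Longrightarrow> finite s \<Longrightarrow> card s < n \<Longrightarrow> c s = p (card s)"
        unfolding hom_def by auto
      have "\<forall>s\<subseteq>Y. finite s \<longrightarrow> card s = n \<longrightarrow> c s \<in> T n" using colours Y(1,2) by blast
      from S'(2)[OF Y(3) this] obtain Z q where Z: "Z \<subseteq> Y" "|S| \<le>o |Z|"
        "\<And>s. s \<subseteq> Z \<Longrightarrow> finite s \<Longrightarrow> card s = n \<Longrightarrow> c s = q" by blast
      have "infinite Z" using S Z(2) card_of_ordLeq_infinite by blast
      then obtain s where s: "s \<subseteq> Z" "finite s" "card s = n" using infinite_arbitrarily_large by metis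
      then have "c s \<in> T (card s)" using Z(1) Y(1,2) by (intro colours[of X]) auto
      then have "q \<in> T n" using Z(3)[OF s] s(3) by simp
      moreover have "hom (Suc n) (p(n := q)) S"
        unfolding hom_def using Y(1,2,4) Z
        by (intro bexI[of _ "(X, c)"] case_prodI exI[of _ Z]) (auto simp: less_Suc_eq)
      ultimately show ?thesis by blast
    qed
    have hom_mono: "hom k q S" if "hom k q S'" "|S| \<le>o |S'|" for k q S S'
    proof -
      from that(1) obtain X c Y where "(X, c) \<in> R" "Y \<subseteq> X" "|S'| \<le>o |Y|"
        "\<forall>s\<subseteq>Y. finite s \<longrightarrow> card s < k \<longrightarrow> c s = q (card s)" unfolding hom_def by auto
      moreover from this have "|S| \<le>o |Y|" using that(2) ordLeq_transitive by blast
      ultimately show ?thesis unfolding hom_def by blast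
    qed
    have "\<exists>q\<in>T n. \<forall>S. small S \<longrightarrow> hom (Suc n) (p(n := q)) S"
    proof (rule ccontr)
      assume "\<not> ?thesis"
      then obtain B where B: "\<And>q. q \<in> T n \<Longrightarrow> small (B q)" "\<And>q. q \<in> T n \<Longrightarrow> \<not> hom (Suc n) (p(n := q)) (B q)"
        by metis
      \<comment> \<open>The countable set \<open>N\<close> makes the common bound infinite.\<close>
      obtain N :: "'u set" and e where "small N" "bij_betw e (UNIV :: nat set) N"
      proof (rule small_for_representative)
        show "small_for TYPE('u) (UNIV :: nat set)"
          using inacc card_of_nat unfolding small_for_def inaccessible_def
          by (meson ordIso_ordLess_trans)
      qed
      then have N: "small N" "infinite N"
        using bij_betw_finite by (blast, metis infinite_UNIV_nat)
      define S where "S = N \<union> (\<Union>q\<in>T n. B q)"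
      have "small_for TYPE('u) (\<Union>A\<in>insert N (B ` T n). A)"
      proof (rule small_for_UN)
        have "insert N (B ` T n) = \<Union> (case_bool {N} (B ` T n) ` UNIV)" by (auto simp: UNIV_bool)
        moreover have "small_for TYPE('u) \<dots>"
          using small_T by (intro small_for_UN) (auto split: bool.split intro: small_for_finite small_for_image)
        ultimately show "small_for TYPE('u) (insert N (B ` T n))" by metis
      qed (use B(1) N(1) in \<open>auto simp: small_for_small\<close>)
      moreover have "(\<Union>A\<in>insert N (B ` T n). A) = S" by (auto simp: S_def)
      ultimately have "small S" by (simp add: small_for_small)
      moreover have "infinite S" using N(2) by (simp add: S_def)
      ultimately obtain q where q: "q \<in> T n" "hom (Suc n) (p(n := q)) S" using * by blast
      have "|B q| \<le>o |S|" using q(1) by (intro card_of_mono1) (auto simp: S_def)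
      then show False using q B(2) hom_mono by blast
    qed
    then obtain q where "\<forall>S. small S \<longrightarrow> hom (Suc n) (p(n := q)) S" by blast
    then show ?thesis by (intro exI[of _ "p(n := q)"]) auto
  qed
  have "\<exists>f. \<forall>n. (\<forall>S. small S \<longrightarrow> hom n (f n) S) \<and> (\<forall>k<n. f (Suc n) k = f n k)"
  proof (rule dependent_nat_choice)
    have "hom 0 p S" if S: "small S" for p S
    proof -
      obtain X c where "(X, c) \<in> R" "|S| \<le>o |X|" using unbounded[OF S] by auto
      then show ?thesis unfolding hom_def by (intro bexI[of _ "(X, c)"] case_prodI exI[of _ X]) auto
    qed
    then show "\<exists>p. \<forall>S. small S \<longrightarrow> hom 0 p S" by blast
    show "\<exists>q. (\<forall>S. small S \<longrightarrow> hom (Suc n) q S) \<and> (\<forall>k<n. q k = p k)"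
      if "\<forall>S. small S \<longrightarrow> hom n p S" for p n
      using step[OF that] by blast
  qed
  then obtain f where f: "\<And>n S. small S \<Longrightarrow> hom n (f n) S" "\<And>n k. k < n \<Longrightarrow> f (Suc n) k = f n k"
    by blast
  have f_eq: "f n k = f (Suc k) k" if "k < n" for n k
    using that
  proof (induction n)
    case (Suc n)
    then show ?case using f(2)[of k n] by (cases "k = n") auto
  qed simp
  show thesis
  proof (rule that[of "\<lambda>k. f (Suc k) k"])
    fix n
    obtain S :: "'u set" where S: "finite S" "card S = n"
      using infinite_universe infinite_arbitrarily_large by metis
    then have "small S" using small_for_finite by (metis small_for_small)
    then have "hom (Suc n) (f (Suc n)) S" by (rule f)
    then obtain X c Y where Y: "(X, c) \<in> R" "Y \<subseteq> X" "|S| \<le>o |Y|"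
      "\<And>s. s \<subseteq> Y \<Longrightarrow> finite s \<Longrightarrow> card s < Suc n \<Longrightarrow> c s = f (Suc n) (card s)"
      unfolding hom_def by auto
    obtain e where e: "inj_on e S" "e ` S \<subseteq> Y" using Y(3) card_of_ordLeq by metis
    have "card s' < Suc n" if "s' \<subseteq> e ` S" for s'
      using card_mono[OF _ that] S e(1) by (simp add: card_image)
    then have "c s' = f (Suc (card s')) (card s')" if "s' \<subseteq> e ` S" for s'
      using that Y(4)[of s'] f_eq[of "card s'" "Suc n"] e(2) S(1)
      by (metis finite_imageI finite_subset subset_trans)
    then show "\<exists>(X, c)\<in>R. \<exists>s\<subseteq>X. finite s \<and> card s = n \<and> (\<forall>s'\<subseteq>s. c s' = f (Suc (card s')) (card s'))"
      using Y(1,2) e S by (intro bexI[of _ "(X, c)"])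
        (auto simp: card_image intro!: exI[of _ "e ` S"])
  qed
qed

end


section \<open>Colimits over posets\<close>

lemma poset_cat_simps [simp]:
  "Obj (poset_cat I r) = I" "Arr (poset_cat I r) = r"
  "Dom (poset_cat I r) = fst" "Cod (poset_cat I r) = snd"
  "Ide (poset_cat I r) i = (i, i)" "Comp (poset_cat I r) v u = (fst u, snd v)"
  by (simp_all add: poset_cat_def)

lemma Hom_poset_cat [simp]: "u \<in> Hom (poset_cat I r) i j \<longleftrightarrow> u = (i, j) \<and> (i, j) \<in> r"
  by (cases u) (auto simp: Hom_def)

lemma cocone_poset_iff:
  "cocone (poset_cat I r) C D x t \<longleftrightarrow> x \<in> Obj C \<and>
     (\<forall>i\<in>I. t i \<in> Hom C (omap D i) x) \<and> (\<forall>i j. (i, j) \<in> r \<longrightarrow> Comp C (t j) (amap D (i, j)) = t i)"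
  by (auto simp: cocone_def)

lemma cocone_cong:
  assumes "r \<subseteq> I \<times> I" "\<And>i. i \<in> I \<Longrightarrow> s i = t i"
  shows "cocone (poset_cat I r) C D x s \<longleftrightarrow> cocone (poset_cat I r) C D x t"
proof -
  have "s i = t i \<and> s j = t j" if "(i, j) \<in> r" for i j
    using assms(1) that assms(2)[of i] assms(2)[of j] by auto
  then show ?thesis unfolding cocone_poset_iff using assms(2) by simp
qed

lemma is_colimit_cong:
  assumes "r \<subseteq> I \<times> I" "\<And>i. i \<in> I \<Longrightarrow> s i = t i"
  shows "is_colimit (poset_cat I r) C D x s \<longleftrightarrow> is_colimit (poset_cat I r) C D x t"
proof -
  have "cocone (poset_cat I r) C D x s \<longleftrightarrow> cocone (poset_cat I r) C D x t"
    using assms by (rule cocone_cong)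
  then show ?thesis using assms(2) by (simp add: is_colimit_def)
qed

lemma directed_posetD:
  assumes "directed_poset I r"
  shows "partial_order_on I r" "I \<noteq> {}" "r \<subseteq> I \<times> I" "i \<in> I \<Longrightarrow> (i, i) \<in> r"
    "(i, j) \<in> r \<Longrightarrow> (j, k) \<in> r \<Longrightarrow> (i, k) \<in> r"
    "i \<in> I \<Longrightarrow> j \<in> I \<Longrightarrow> \<exists>k\<in>I. (i, k) \<in> r \<and> (j, k) \<in> r"
proof -
  show po: "partial_order_on I r" and "I \<noteq> {}"
    "i \<in> I \<Longrightarrow> j \<in> I \<Longrightarrow> \<exists>k\<in>I. (i, k) \<in> r \<and> (j, k) \<in> r"
    using assms by (auto simp: directed_poset_def)
  show "r \<subseteq> I \<times> I" "i \<in> I \<Longrightarrow> (i, i) \<in> r" "(i, j) \<in> r \<Longrightarrow> (j, k) \<in> r \<Longrightarrow> (i, k) \<in> r"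
    using partial_order_onD[OF po] by (auto simp: refl_on_def dest: transD)
qed

lemma directed_poset_finite_bound:
  assumes "directed_poset I r" "finite F" "F \<subseteq> I"
  obtains k where "k \<in> I" "\<And>i. i \<in> F \<Longrightarrow> (i, k) \<in> r"
proof -
  have "\<exists>k\<in>I. \<forall>i\<in>F. (i, k) \<in> r"
    using assms(2,3)
  proof (induction F)
    case empty
    then show ?case using directed_posetD(2)[OF assms(1)] by auto
  next
    case (insert j F)
    then obtain k where k: "k \<in> I" "\<And>i. i \<in> F \<Longrightarrow> (i, k) \<in> r" by auto
    obtain l where "l \<in> I" "(k, l) \<in> r" "(j, l) \<in> r"
      using directed_posetD(6)[OF assms(1) k(1), of j] insert.prems by auto
    then show ?case using k directed_posetD(5)[OF assms(1)] by blast
  qed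
  then show thesis using that by blast
qed

lemma poset_functorI:
  assumes "category C" "partial_order_on I r"
    and "\<And>i. i \<in> I \<Longrightarrow> omap D i \<in> Obj C"
    and "\<And>i j. (i, j) \<in> r \<Longrightarrow> amap D (i, j) \<in> Hom C (omap D i) (omap D j)"
    and "\<And>i. i \<in> I \<Longrightarrow> amap D (i, i) = Ide C (omap D i)"
    and "\<And>i j k. (i, j) \<in> r \<Longrightarrow> (j, k) \<in> r \<Longrightarrow>
      amap D (i, k) = Comp C (amap D (j, k)) (amap D (i, j))"
  shows "cat_functor (poset_cat I r) C D"
proof -
  interpret C: category C by fact
  interpret J: category "poset_cat I r" by (rule category_poset_cat) fact
  show ?thesis using assms(3-6) by unfold_locales auto
qed

lemma poset_functorD:
  assumes "cat_functor (poset_cat I r) C D"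
  shows "i \<in> I \<Longrightarrow> omap D i \<in> Obj C"
    and "(i, j) \<in> r \<Longrightarrow> amap D (i, j) \<in> Hom C (omap D i) (omap D j)"
    and "i \<in> I \<Longrightarrow> amap D (i, i) = Ide C (omap D i)"
    and "(i, j) \<in> r \<Longrightarrow> (j, k) \<in> r \<Longrightarrow>
      amap D (i, k) = Comp C (amap D (j, k)) (amap D (i, j))"
proof -
  interpret cat_functor "poset_cat I r" C D by fact
  show "i \<in> I \<Longrightarrow> omap D i \<in> Obj C"
    "i \<in> I \<Longrightarrow> amap D (i, i) = Ide C (omap D i)"
    using omap_in_Obj[of i] amap_Ide[of i] by auto
  show "(i, j) \<in> r \<Longrightarrow> amap D (i, j) \<in> Hom C (omap D i) (omap D j)"
    using amap_in_Hom[of "(i, j)" i j] by auto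
  show "(i, j) \<in> r \<Longrightarrow> (j, k) \<in> r \<Longrightarrow>
      amap D (i, k) = Comp C (amap D (j, k)) (amap D (i, j))"
    using amap_Comp[of "(i, j)" i j "(j, k)" k] by auto
qed

lemma cocone_reindex:
  assumes "\<And>j. j \<in> J \<Longrightarrow> omap D' (e j) = omap D j"
    and "\<And>i j. (i, j) \<in> r \<Longrightarrow> amap D' (e i, e j) = amap D (i, j)"
  shows "cocone (poset_cat (e ` J) (map_prod e e ` r)) C D' x s
    \<longleftrightarrow> cocone (poset_cat J r) C D x (s \<circ> e)"
  using assms unfolding cocone_poset_iff by (fastforce simp: map_prod_def)

text \<open>
  Directed colimits and finite presentability are defined through index posets inside the universe.
  Reindexing makes them available for posets of finite subsets.
\<close>

lemma is_colimit_reindex: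
  assumes e: "inj_on e J" and r: "r \<subseteq> J \<times> J"
    and D: "\<And>j. j \<in> J \<Longrightarrow> omap D' (e j) = omap D j"
      "\<And>i j. (i, j) \<in> r \<Longrightarrow> amap D' (e i, e j) = amap D (i, j)"
  shows "is_colimit (poset_cat (e ` J) (map_prod e e ` r)) C D' x t
    \<longleftrightarrow> is_colimit (poset_cat J r) C D x (t \<circ> e)"
proof -
  note cocone_iff = cocone_reindex[where D = D and D' = D' and r = r and C = C, OF D]
  have cong: "cocone (poset_cat J r) C D y s \<longleftrightarrow> cocone (poset_cat J r) C D y (s \<circ> inv_into J e \<circ> e)"
    for y s
    using e by (intro cocone_cong[OF r]) simp
  show ?thesis
  proof
    assume L: "is_colimit (poset_cat (e ` J) (map_prod e e ` r)) C D' x t"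
    show "is_colimit (poset_cat J r) C D x (t \<circ> e)"
      unfolding is_colimit_def
    proof (intro conjI allI impI)
      show "cocone (poset_cat J r) C D x (t \<circ> e)" using L cocone_iff by (simp add: is_colimit_def)
      fix y s assume "cocone (poset_cat J r) C D y s"
      then have "cocone (poset_cat (e ` J) (map_prod e e ` r)) C D' y (s \<circ> inv_into J e)"
        using cong cocone_iff by blast
      then have "\<exists>!h. h \<in> Hom C x y \<and> (\<forall>j\<in>e ` J. Comp C h (t j) = (s \<circ> inv_into J e) j)"
        using L unfolding is_colimit_def poset_cat_simps by blast
      then show "\<exists>!h. h \<in> Hom C x y \<and> (\<forall>j\<in>Obj (poset_cat J r). Comp C h ((t \<circ> e) j) = s j)"
        using e by simp
    qed
  next
    assume R: "is_colimit (poset_cat J r) C D x (t \<circ> e)"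
    show "is_colimit (poset_cat (e ` J) (map_prod e e ` r)) C D' x t"
      unfolding is_colimit_def
    proof (intro conjI allI impI)
      show "cocone (poset_cat (e ` J) (map_prod e e ` r)) C D' x t"
        using R cocone_iff by (simp add: is_colimit_def)
      fix y s assume "cocone (poset_cat (e ` J) (map_prod e e ` r)) C D' y s"
      then have "cocone (poset_cat J r) C D y (s \<circ> e)" using cocone_iff by blast
      then have "\<exists>!h. h \<in> Hom C x y \<and> (\<forall>j\<in>J. Comp C h ((t \<circ> e) j) = (s \<circ> e) j)"
        using R unfolding is_colimit_def poset_cat_simps by blast
      then show "\<exists>!h. h \<in> Hom C x y \<and>
          (\<forall>j\<in>Obj (poset_cat (e ` J) (map_prod e e ` r)). Comp C h (t j) = s j)"
        by simp
    qed
  qed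
qed

lemma directed_poset_reindex:
  assumes e: "inj_on e J" and dir: "directed_poset J r"
  shows "directed_poset (e ` J) (map_prod e e ` r)"
proof -
  note r = directed_posetD[OF dir]
  have anti: "antisym r" using r(1) by (simp add: partial_order_on_def)
  have im: "(i, j) \<in> r" if "i \<in> J" "j \<in> J" "(e i, e j) \<in> map_prod e e ` r" for i j
    using that e r(3) by (auto dest!: inj_onD[OF e])
  have "refl_on (e ` J) (map_prod e e ` r)"
    using r(3,4) by (auto simp: refl_on_def)
  moreover have "trans (map_prod e e ` r)"
  proof (rule transI)
    fix x y z assume xyz: "(x, y) \<in> map_prod e e ` r" "(y, z) \<in> map_prod e e ` r"
    then obtain i j k where "i \<in> J" "j \<in> J" "k \<in> J" "x = e i" "y = e j" "z = e k" using r(3) by auto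
    then show "(x, z) \<in> map_prod e e ` r" using xyz im r(5) by (metis image_eqI map_prod_simp)
  qed
  moreover have "antisym (map_prod e e ` r)"
  proof (rule antisymI)
    fix x y assume xy: "(x, y) \<in> map_prod e e ` r" "(y, x) \<in> map_prod e e ` r"
    then obtain i j where "i \<in> J" "j \<in> J" "x = e i" "y = e j" using r(3) by auto
    then show "x = y" using xy im antisymD[OF anti] by metis
  qed
  moreover have "map_prod e e ` r \<subseteq> e ` J \<times> e ` J" using r(3) by auto
  moreover have "\<forall>x\<in>e ` J. \<forall>y\<in>e ` J. \<exists>z\<in>e ` J. (x, z) \<in> map_prod e e ` r \<and> (y, z) \<in> map_prod e e ` r"
  proof (intro ballI)
    fix x y assume "x \<in> e ` J" "y \<in> e ` J"
    then obtain i j where ij: "i \<in> J" "j \<in> J" "x = e i" "y = e j" by auto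
    then obtain k where "k \<in> J" "(i, k) \<in> r" "(j, k) \<in> r" using r(6) by blast
    then show "\<exists>z\<in>e ` J. (x, z) \<in> map_prod e e ` r \<and> (y, z) \<in> map_prod e e ` r"
      using ij by (metis image_eqI map_prod_simp)
  qed
  ultimately show ?thesis
    using r(2) unfolding directed_poset_def partial_order_on_def preorder_on_def by simp
qed

context category
begin

lemma HomD: "f \<in> Hom C x y \<Longrightarrow> f \<in> Arr C \<and> Dom C f = x \<and> Cod C f = y \<and> x \<in> Obj C \<and> y \<in> Obj C"
  using Dom_in_Obj Cod_in_Obj by (auto simp: Hom_def)

lemma colimit_poset:
  assumes "is_colimit (poset_cat I r) C D x t"
  shows colimit_Obj: "x \<in> Obj C"
    and colimit_leg: "i \<in> I \<Longrightarrow> t i \<in> Hom C (omap D i) x"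
    and colimit_compat: "(i, j) \<in> r \<Longrightarrow> Comp C (t j) (amap D (i, j)) = t i"
  using assms by (auto simp: is_colimit_def cocone_poset_iff)

lemma colimit_factor:
  assumes "is_colimit (poset_cat I r) C D x t" "y \<in> Obj C"
    and "\<And>i. i \<in> I \<Longrightarrow> s i \<in> Hom C (omap D i) y"
    and "\<And>i j. (i, j) \<in> r \<Longrightarrow> Comp C (s j) (amap D (i, j)) = s i"
  obtains h where "h \<in> Hom C x y" "\<And>i. i \<in> I \<Longrightarrow> Comp C h (t i) = s i"
proof -
  have "cocone (poset_cat I r) C D y s" using assms(2-4) by (simp add: cocone_poset_iff)
  then have "\<exists>!h. h \<in> Hom C x y \<and> (\<forall>i\<in>I. Comp C h (t i) = s i)"
    using assms(1) by (simp add: is_colimit_def)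
  then show thesis using that by blast
qed

lemma colimit_eqI:
  assumes fun_D: "cat_functor (poset_cat I r) C D" and r: "r \<subseteq> I \<times> I"
    and colim: "is_colimit (poset_cat I r) C D x t"
    and h: "h \<in> Hom C x y" "h' \<in> Hom C x y"
    and eq: "\<And>i. i \<in> I \<Longrightarrow> Comp C h (t i) = Comp C h' (t i)"
  shows "h = h'"
proof -
  have "cocone (poset_cat I r) C D y (\<lambda>i. Comp C h (t i))"
    unfolding cocone_poset_iff
  proof (intro conjI ballI allI impI)
    show "y \<in> Obj C" using HomD h by blast
    show "Comp C h (t i) \<in> Hom C (omap D i) y" if "i \<in> I" for i
      using Comp_in_Hom[OF colimit_leg[OF colim that] h(1)] .
    fix i j assume ij: "(i, j) \<in> r"
    then have "j \<in> I" using r by auto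
    then show "Comp C (Comp C h (t j)) (amap D (i, j)) = Comp C h (t i)"
      using Comp_assoc[OF poset_functorD(2)[OF fun_D ij] colimit_leg[OF colim] h(1)]
        colimit_compat[OF colim ij] by simp
  qed
  then have "\<exists>!k. k \<in> Hom C x y \<and> (\<forall>i\<in>I. Comp C k (t i) = Comp C h (t i))"
    using colim by (auto simp: is_colimit_def)
  then show "h = h'" using h eq by (metis (no_types, lifting))
qed

end


section \<open>Finitely presentable objects\<close>

abbreviation map_of_arrow :: "'s set \<times> ('s \<Rightarrow> 's) \<times> 's set \<Rightarrow> 's \<Rightarrow> 's" where
  "map_of_arrow f \<equiv> fst (snd f)"

lemma Hom_SET_iff:
  "f \<in> Hom SET A B \<longleftrightarrow> small A \<and> small B \<and> f = (A, map_of_arrow f, B) \<and> map_of_arrow f \<in> A \<rightarrow>\<^sub>E B"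
  by (cases f) (auto simp: Hom_def SET_def)

lemma Comp_SET: "Comp SET (B, g, Z) (A, f, B') = (A, compose A g f, Z)"
  by (simp add: SET_def)

text \<open>
  A compatible family of predicates is a cocone on a two-element set. Colimits of sets are thereby
  analysed without constructing quotients.
\<close>

lemma SET_colimit_predicate:
  fixes p q :: 'u and X :: "'u set"
  assumes fun_D: "cat_functor (poset_cat I r) SET D" and r: "r \<subseteq> I \<times> I"
    and colim: "is_colimit (poset_cat I r) SET D X t"
    and pq: "p \<noteq> q" "small {p, q}"
    and P: "\<And>i j u. (i, j) \<in> r \<Longrightarrow> u \<in> omap D i \<Longrightarrow> P j (map_of_arrow (amap D (i, j)) u) = P i u"
  obtains Q where "\<And>i u. i \<in> I \<Longrightarrow> u \<in> omap D i \<Longrightarrow> Q (map_of_arrow (t i) u) \<longleftrightarrow> P i u"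
proof -
  interpret category SET by (rule category_SET)
  define s where "s i = (omap D i, \<lambda>u\<in>omap D i. if P i u then p else q, {p, q})" for i
  have D_Obj: "small (omap D i)" if "i \<in> I" for i
    using poset_functorD(1)[OF fun_D that] by (simp add: SET_def)
  have t: "t i = (omap D i, map_of_arrow (t i), X)" "map_of_arrow (t i) \<in> omap D i \<rightarrow>\<^sub>E X" if "i \<in> I" for i
    using colimit_leg[OF colim that] unfolding Hom_SET_iff by auto
  obtain h where h: "h \<in> Hom SET X {p, q}" "\<And>i. i \<in> I \<Longrightarrow> Comp SET h (t i) = s i"
  proof (rule colimit_factor[OF colim])
    show "{p, q} \<in> Obj SET" using pq(2) by (simp add: SET_def)
    show "s i \<in> Hom SET (omap D i) {p, q}" if "i \<in> I" for i
      using D_Obj[OF that] pq(2) by (auto simp: Hom_SET_iff s_def)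
    show "Comp SET (s j) (amap D (i, j)) = s i" if ij: "(i, j) \<in> r" for i j
    proof -
      have a: "amap D (i, j) = (omap D i, map_of_arrow (amap D (i, j)), omap D j)"
        "map_of_arrow (amap D (i, j)) \<in> omap D i \<rightarrow>\<^sub>E omap D j"
        using poset_functorD(2)[OF fun_D ij] unfolding Hom_SET_iff by auto
      have "Comp SET (s j) (amap D (i, j)) = (omap D i, compose (omap D i)
          (\<lambda>u\<in>omap D j. if P j u then p else q) (map_of_arrow (amap D (i, j))), {p, q})"
        by (subst a(1)) (simp add: s_def Comp_SET)
      also have "\<dots> = s i"
        using PiE_mem[OF a(2)] P[OF ij] by (auto simp: s_def compose_def restrict_def fun_eq_iff)
      finally show ?thesis .
    qed
  qed (use that in blast)
  show thesis
  proof (rule that[of "\<lambda>y. map_of_arrow h y = p"])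
    fix i u assume i: "i \<in> I" and u: "u \<in> omap D i"
    have h': "h = (X, map_of_arrow h, {p, q})" using h(1) unfolding Hom_SET_iff by auto
    have "Comp SET h (t i) = (omap D i, compose (omap D i) (map_of_arrow h) (map_of_arrow (t i)), {p, q})"
      by (subst h', subst t(1)[OF i]) (simp add: Comp_SET)
    then have "compose (omap D i) (map_of_arrow h) (map_of_arrow (t i)) u = map_of_arrow (s i) u"
      using h(2)[OF i] by (metis fst_conv snd_conv)
    then show "map_of_arrow h (map_of_arrow (t i) u) = p \<longleftrightarrow> P i u"
      using u pq(1) by (auto simp: compose_def s_def)
  qed
qed

text \<open>
  If \<open>y\<close> were missed by all legs, then two maps to \<open>{p, q}\<close> that differ at \<open>y\<close> only would agree
  on all legs.
\<close>

lemma SET_colimit_jointly_surjective: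
  fixes p q :: 'u and X :: "'u set"
  assumes fun_D: "cat_functor (poset_cat I r) SET D" and r: "r \<subseteq> I \<times> I"
    and colim: "is_colimit (poset_cat I r) SET D X t"
    and pq: "p \<noteq> q" "small {p, q}" and y: "y \<in> X"
  obtains i u where "i \<in> I" "u \<in> omap D i" "map_of_arrow (t i) u = y"
proof -
  interpret category SET by (rule category_SET)
  have X: "small X" using colimit_Obj[OF colim] by (simp add: SET_def)
  have t: "t i = (omap D i, map_of_arrow (t i), X)" "map_of_arrow (t i) \<in> omap D i \<rightarrow>\<^sub>E X" if "i \<in> I" for i
    using colimit_leg[OF colim that] unfolding Hom_SET_iff by auto
  let ?h = "\<lambda>w. (X, \<lambda>x\<in>X. if x = y then w else q, {p, q})"
  show thesis
  proof (rule ccontr)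
    note found = that
    assume no: "\<not> thesis"
    have "?h p = ?h q"
    proof (rule colimit_eqI[OF fun_D r colim])
      show "?h p \<in> Hom SET X {p, q}" "?h q \<in> Hom SET X {p, q}"
        using X pq(2) by (auto simp: Hom_SET_iff)
      fix i assume i: "i \<in> I"
      have "map_of_arrow (t i) u \<noteq> y" if "u \<in> omap D i" for u using no found[of i u] i that by blast
      then have "compose (omap D i) (\<lambda>x\<in>X. if x = y then p else q) (map_of_arrow (t i))
          = compose (omap D i) (\<lambda>x\<in>X. if x = y then q else q) (map_of_arrow (t i))"
        using PiE_mem[OF t(2)[OF i]] by (auto simp: compose_def fun_eq_iff)
      then show "Comp SET (?h p) (t i) = Comp SET (?h q) (t i)"
        by (subst (1 2) t(1)[OF i]) (simp add: Comp_SET)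
    qed
    then have "(\<lambda>x\<in>X. if x = y then p else q) y = (\<lambda>x\<in>X. if x = y then q else q) y" by simp
    then show False using y pq(1) by simp
  qed
qed

text \<open>
  The generating set \<open>\<A>\<close>, which the definition of finite accessibility merely asserts to exist, is fixed.
\<close>

locale accessible_presentation = category K for K :: "('u, 'u) cat" +
  fixes \<A> :: "'u set"
  assumes inacc: "inaccessible |UNIV :: 'u set|"
    and locally_small: "locally_small K"
    and directed_colimits: "has_directed_colimits K"
    and small_\<A>: "small \<A>"
    and presentable: "a \<in> \<A> \<Longrightarrow> finitely_presentable K a"
    and presentation: "x \<in> Obj K \<Longrightarrow> \<exists>(I :: 'u set) r D t.
      small I \<and> directed_poset I r \<and> cat_functor (poset_cat I r) K D \<and>
      (\<forall>i\<in>I. omap D i \<in> \<A>) \<and> is_colimit (poset_cat I r) K D x t"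
begin

lemma \<A>_Obj: "a \<in> \<A> \<Longrightarrow> a \<in> Obj K"
  using presentable by (auto simp: finitely_presentable_def)

lemma small_Hom: "x \<in> Obj K \<Longrightarrow> y \<in> Obj K \<Longrightarrow> small (Hom K x y)"
  using locally_small by (simp add: locally_small_def)

lemma two_points: obtains p q :: 'u where "p \<noteq> q" "small {p, q}"
proof -
  obtain S :: "'u set" where "finite S" "card S = 2"
    using infinite_universe[OF inacc] infinite_arbitrarily_large by metis
  then obtain p q where "p \<noteq> q" "S = {p, q}" by (auto simp: card_2_iff)
  moreover have "small {p, q}"
    using small_for_finite[OF inacc, of "{p, q}"] by (simp add: small_for_small)
  ultimately show thesis using that by blast
qed

text \<open>
  The usual description of a finitely presentable object \<open>b\<close>: arrows from \<open>b\<close> to a directed colimit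
  factor through some stage, in a way which is unique up to passing to a later stage. The
  first part is joint surjectivity of the legs of the colimit of the sets \<open>Hom(b, D i)\<close>. For the
  second, the property of an arrow to become equal to \<open>u\<close> eventually is respected by the diagram,
  so it can be tested in the colimit.
\<close>

lemma
  fixes I :: "'u set"
  assumes b: "finitely_presentable K b" and I: "small I" and dir: "directed_poset I r"
    and fun_D: "cat_functor (poset_cat I r) K D" and colim: "is_colimit (poset_cat I r) K D x t"
  shows presentable_factor_universe:
      "f \<in> Hom K b x \<Longrightarrow> \<exists>i\<in>I. \<exists>u\<in>Hom K b (omap D i). Comp K (t i) u = f"
    and presentable_eq_universe:
      "i \<in> I \<Longrightarrow> u \<in> Hom K b (omap D i) \<Longrightarrow> v \<in> Hom K b (omap D i) \<Longrightarrow>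
        Comp K (t i) u = Comp K (t i) v \<Longrightarrow>
        \<exists>k. (i, k) \<in> r \<and> Comp K (amap D (i, k)) u = Comp K (amap D (i, k)) v"
proof -
  let ?H = "hom_functor K b"
  let ?D = "func_comp ?H D"
  note r = directed_posetD[OF dir]
  obtain p q :: 'u where pq: "p \<noteq> q" "small {p, q}" by (rule two_points)
  have b_Obj: "b \<in> Obj K" using b by (simp add: finitely_presentable_def)
  have colim': "is_colimit (poset_cat I r) SET ?D (omap ?H x) (amap ?H \<circ> t)"
    using b I dir fun_D colim by (auto simp: finitely_presentable_def preserves_directed_colimits_def)
  interpret H: cat_functor K SET ?H
    using category_axioms locally_small b_Obj by (rule cat_functor_hom_functor)
  have omap_D: "omap ?D i = Hom K b (omap D i)" for i by (simp add: func_comp_def hom_functor_def)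
  have fun_D': "cat_functor (poset_cat I r) SET ?D"
  proof (rule poset_functorI[OF category_SET r(1)])
    show "omap ?D i \<in> Obj SET" if "i \<in> I" for i
      using poset_functorD(1)[OF fun_D that] H.omap_in_Obj by (simp add: func_comp_def)
    show "amap ?D (i, j) \<in> Hom SET (omap ?D i) (omap ?D j)" if "(i, j) \<in> r" for i j
      using poset_functorD(2)[OF fun_D that] H.amap_in_Hom by (simp add: func_comp_def)
    show "amap ?D (i, i) = Ide SET (omap ?D i)" if "i \<in> I" for i
      using poset_functorD(1,3)[OF fun_D that] H.amap_Ide by (simp add: func_comp_def)
    show "amap ?D (i, k) = Comp SET (amap ?D (j, k)) (amap ?D (i, j))"
      if "(i, j) \<in> r" "(j, k) \<in> r" for i j k
      using poset_functorD(2)[OF fun_D that(1)] poset_functorD(2)[OF fun_D that(2)]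
        poset_functorD(4)[OF fun_D that] H.amap_Comp by (simp add: func_comp_def)
  qed
  have leg: "map_of_arrow ((amap ?H \<circ> t) i) u = Comp K (t i) u"
    if "i \<in> I" "u \<in> Hom K b (omap D i)" for i u
    using that HomD[OF colimit_leg[OF colim that(1)]] by (simp add: hom_functor_def)
  have step: "map_of_arrow (amap ?D (i, j)) u = Comp K (amap D (i, j)) u"
    if "(i, j) \<in> r" "u \<in> Hom K b (omap D i)" for i j u
    using that HomD[OF poset_functorD(2)[OF fun_D that(1)]] by (simp add: hom_functor_def func_comp_def)
  show "\<exists>i\<in>I. \<exists>u\<in>Hom K b (omap D i). Comp K (t i) u = f" if "f \<in> Hom K b x"
  proof -
    have "f \<in> omap ?H x" using that by (simp add: hom_functor_def)
    then obtain i u where "i \<in> I" "u \<in> omap ?D i" "map_of_arrow ((amap ?H \<circ> t) i) u = f"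
      by (rule SET_colimit_jointly_surjective[OF fun_D' r(3) colim' pq])
    then show ?thesis using leg omap_D by metis
  qed
  assume i: "i \<in> I" and u: "u \<in> Hom K b (omap D i)" and v: "v \<in> Hom K b (omap D i)"
    and eq: "Comp K (t i) u = Comp K (t i) v"
  \<comment> \<open>Being eventually equal to \<open>u\<close> is a predicate on the diagram.\<close>
  define P where "P j w \<longleftrightarrow> (\<exists>k. (i, k) \<in> r \<and> (j, k) \<in> r \<and>
      Comp K (amap D (i, k)) u = Comp K (amap D (j, k)) w)" for j w
  obtain Q where Q: "\<And>j w. j \<in> I \<Longrightarrow> w \<in> omap ?D j \<Longrightarrow> Q (map_of_arrow ((amap ?H \<circ> t) j) w) \<longleftrightarrow> P j w"
  proof (rule SET_colimit_predicate[OF fun_D' r(3) colim' pq, where P = P])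
    fix j l w assume jl: "(j, l) \<in> r" and "w \<in> omap ?D j"
    then have w: "w \<in> Hom K b (omap D j)" by (simp add: omap_D)
    have push: "Comp K (amap D (l, k)) (Comp K (amap D (j, l)) w) = Comp K (amap D (j, k)) w"
      if "(l, k) \<in> r" for k
      using Comp_assoc[OF w poset_functorD(2)[OF fun_D jl] poset_functorD(2)[OF fun_D that]]
        poset_functorD(4)[OF fun_D jl that] by simp
    have "P l (Comp K (amap D (j, l)) w) \<longleftrightarrow> P j w"
    proof
      assume "P l (Comp K (amap D (j, l)) w)"
      then obtain k where "(i, k) \<in> r" "(l, k) \<in> r"
        "Comp K (amap D (i, k)) u = Comp K (amap D (l, k)) (Comp K (amap D (j, l)) w)"
        unfolding P_def by blast
      then show "P j w" using push r(5)[OF jl] unfolding P_def by metis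
    next
      assume "P j w"
      then obtain k where k: "(i, k) \<in> r" "(j, k) \<in> r"
        "Comp K (amap D (i, k)) u = Comp K (amap D (j, k)) w" unfolding P_def by blast
      obtain m where m: "(k, m) \<in> r" "(l, m) \<in> r"
        using r(6)[of k l] r(3) k(1) jl by blast
      have "Comp K (amap D (i, m)) u = Comp K (amap D (k, m)) (Comp K (amap D (i, k)) u)"
        using Comp_assoc[OF u poset_functorD(2)[OF fun_D k(1)] poset_functorD(2)[OF fun_D m(1)]]
          poset_functorD(4)[OF fun_D k(1) m(1)] by simp
      also have "\<dots> = Comp K (amap D (j, m)) w"
        using Comp_assoc[OF w poset_functorD(2)[OF fun_D k(2)] poset_functorD(2)[OF fun_D m(1)]]
          poset_functorD(4)[OF fun_D k(2) m(1)] k(3) by simp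
      also have "\<dots> = Comp K (amap D (l, m)) (Comp K (amap D (j, l)) w)" using push[OF m(2)] by simp
      finally show "P l (Comp K (amap D (j, l)) w)"
        unfolding P_def using r(5)[OF k(1) m(1)] m(2) by blast
    qed
    then show "P l (map_of_arrow (amap ?D (j, l)) w) = P j w" using step[OF jl w] by simp
  qed (use that in blast)
  have "P i u" using r(4)[OF i] unfolding P_def by blast
  then have "P i v" using Q[OF i] leg[OF i] u v eq omap_D by metis
  then obtain k where k: "(i, k) \<in> r" "Comp K (amap D (i, k)) u = Comp K (amap D (i, k)) v"
    unfolding P_def by blast
  then show "\<exists>k. (i, k) \<in> r \<and> Comp K (amap D (i, k)) u = Comp K (amap D (i, k)) v" by blast
qed

lemma reindexed_diagram:
  fixes e :: "'j \<Rightarrow> 'u"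
  assumes e: "inj_on e J" and dir: "directed_poset J r" and fun_D: "cat_functor (poset_cat J r) K D"
  obtains D' where "\<And>j. j \<in> J \<Longrightarrow> omap D' (e j) = omap D j"
    "\<And>i j. (i, j) \<in> r \<Longrightarrow> amap D' (e i, e j) = amap D (i, j)"
    "cat_functor (poset_cat (e ` J) (map_prod e e ` r)) K D'"
proof -
  note r = directed_posetD[OF dir]
  let ?d = "inv_into J e"
  define D' where "D' = \<lparr>omap = \<lambda>i. omap D (?d i), amap = \<lambda>(i, j). amap D (?d i, ?d j)\<rparr>"
  have 1: "omap D' (e j) = omap D j" if "j \<in> J" for j using that e by (simp add: D'_def)
  have 2: "amap D' (e i, e j) = amap D (i, j)" if "(i, j) \<in> r" for i j
  proof -
    have "i \<in> J" "j \<in> J" using that r(3) by auto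
    then show ?thesis using e by (simp add: D'_def)
  qed
  have "cat_functor (poset_cat (e ` J) (map_prod e e ` r)) K D'"
  proof (rule poset_functorI[OF category_axioms])
    show "partial_order_on (e ` J) (map_prod e e ` r)"
      using directed_posetD(1)[OF directed_poset_reindex[OF e dir]] .
    show "omap D' i \<in> Obj K" if "i \<in> e ` J" for i
      using that 1 poset_functorD(1)[OF fun_D] by auto
    show "amap D' (i, i) = Ide K (omap D' i)" if i: "i \<in> e ` J" for i
    proof -
      obtain j where "j \<in> J" "i = e j" using i by auto
      then show ?thesis using 1 2 r(4) poset_functorD(3)[OF fun_D] by metis
    qed
    show "amap D' (i, j) \<in> Hom K (omap D' i) (omap D' j)" if "(i, j) \<in> map_prod e e ` r" for i j
    proof -
      from that obtain i' j' where "(i', j') \<in> r" "i = e i'" "j = e j'" by auto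
      moreover from this have "i' \<in> J" "j' \<in> J" using r(3) by auto
      ultimately show ?thesis using 1 2 poset_functorD(2)[OF fun_D] by metis
    qed
    fix i j k assume "(i, j) \<in> map_prod e e ` r" "(j, k) \<in> map_prod e e ` r"
    then obtain i' j' j'' k' where *: "(i', j') \<in> r" "i = e i'" "j = e j'" "(j'', k') \<in> r" "j = e j''" "k = e k'"
      by auto
    then have "j'' = j'" using inj_onD[OF e] r(3) by (metis SigmaD1 SigmaD2 subsetD)
    then show "amap D' (i, k) = Comp K (amap D' (j, k)) (amap D' (i, j))"
      using * 2 r(5) poset_functorD(4)[OF fun_D] by metis
  qed
  then show thesis using 1 2 that by blast
qed

lemma directed_colimit_exists:
  fixes J :: "'j set"
  assumes J: "small_for TYPE('u) J" and dir: "directed_poset J r"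
    and fun_D: "cat_functor (poset_cat J r) K D"
  shows "\<exists>x t. is_colimit (poset_cat J r) K D x t"
proof -
  obtain S :: "'u set" and e where e: "small S" "bij_betw e J S" by (rule small_for_representative[OF J])
  then have inj: "inj_on e J" and S: "S = e ` J" by (auto simp: bij_betw_def)
  obtain D' where D': "\<And>j. j \<in> J \<Longrightarrow> omap D' (e j) = omap D j"
    "\<And>i j. (i, j) \<in> r \<Longrightarrow> amap D' (e i, e j) = amap D (i, j)"
    "cat_functor (poset_cat (e ` J) (map_prod e e ` r)) K D'"
    using reindexed_diagram[OF inj dir fun_D] by blast
  obtain x t where "is_colimit (poset_cat (e ` J) (map_prod e e ` r)) K D' x t"
    using directed_colimits e(1) S directed_poset_reindex[OF inj dir] D'(3)
    unfolding has_directed_colimits_def by metis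
  then show ?thesis
    using is_colimit_reindex[OF inj directed_posetD(3)[OF dir] D'(1,2)] by blast
qed

lemma presentable_eq:
  fixes J :: "'j set"
  assumes b: "finitely_presentable K b" and J: "small_for TYPE('u) J" and dir: "directed_poset J r"
    and fun_D: "cat_functor (poset_cat J r) K D" and colim: "is_colimit (poset_cat J r) K D x t"
    and i: "i \<in> J" and uv: "u \<in> Hom K b (omap D i)" "v \<in> Hom K b (omap D i)"
    and eq: "Comp K (t i) u = Comp K (t i) v"
  shows "\<exists>k. (i, k) \<in> r \<and> Comp K (amap D (i, k)) u = Comp K (amap D (i, k)) v"
proof -
  obtain S :: "'u set" and e where e: "small S" "bij_betw e J S" by (rule small_for_representative[OF J])
  then have inj: "inj_on e J" and S: "S = e ` J" by (auto simp: bij_betw_def)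
  obtain D' where D': "\<And>j. j \<in> J \<Longrightarrow> omap D' (e j) = omap D j"
    "\<And>i j. (i, j) \<in> r \<Longrightarrow> amap D' (e i, e j) = amap D (i, j)"
    "cat_functor (poset_cat (e ` J) (map_prod e e ` r)) K D'"
    using reindexed_diagram[OF inj dir fun_D] by blast
  let ?t = "t \<circ> inv_into J e"
  have "is_colimit (poset_cat J r) K D x (?t \<circ> e) \<longleftrightarrow> is_colimit (poset_cat J r) K D x t"
    using inj by (intro is_colimit_cong[OF directed_posetD(3)[OF dir]]) simp
  then have "is_colimit (poset_cat J r) K D x (?t \<circ> e)" using colim by simp
  then have colim': "is_colimit (poset_cat (e ` J) (map_prod e e ` r)) K D' x ?t"
    using is_colimit_reindex[OF inj directed_posetD(3)[OF dir] D'(1,2)] by blast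
  have "\<exists>k. (e i, k) \<in> map_prod e e ` r \<and> Comp K (amap D' (e i, k)) u = Comp K (amap D' (e i, k)) v"
    using e(1) S i uv eq D'(1)[OF i] inj
    by (intro presentable_eq_universe[OF b _ directed_poset_reindex[OF inj dir] D'(3) colim']) auto
  then obtain i' k' where "(i', k') \<in> r" "e i = e i'"
    "Comp K (amap D' (e i', e k')) u = Comp K (amap D' (e i', e k')) v" by auto
  moreover from this have "i' = i" using inj_onD[OF inj] i directed_posetD(3)[OF dir] by (metis SigmaD1 subsetD)
  ultimately show ?thesis using D'(2) by metis
qed


section \<open>Large categories have large hom-sets\<close>

lemma Hom_eqI:
  assumes h: "h \<in> Hom K x y" "h' \<in> Hom K x y"
    and eq: "\<And>a u. a \<in> \<A> \<Longrightarrow> u \<in> Hom K a x \<Longrightarrow> Comp K h u = Comp K h' u"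
  shows "h = h'"
proof -
  have "x \<in> Obj K" using HomD h(1) by blast
  then obtain I :: "'u set" and r D t where *: "directed_poset I r" "cat_functor (poset_cat I r) K D"
    "\<forall>i\<in>I. omap D i \<in> \<A>" "is_colimit (poset_cat I r) K D x t"
    using presentation by metis
  show ?thesis
    using colimit_leg[OF *(4)] *(3) eq
    by (intro colimit_eqI[OF *(2) directed_posetD(3)[OF *(1)] *(4) h]) blast
qed

text \<open>
  The objects of \<open>\<A>\<close> are dense: arrows \<open>x \<rightarrow> y\<close> amount to natural transformations between the presheaves
  \<open>Hom(-, x)\<close> and \<open>Hom(-, y)\<close> on \<open>\<A>\<close>. A natural transformation is a cocone on a presentation of \<open>x\<close>, and it
  is recovered from the induced arrow because every arrow \<open>a \<rightarrow> x\<close> factors through a leg.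
\<close>

lemma Hom_induced:
  assumes x: "x \<in> Obj K" and y: "y \<in> Obj K"
    and \<theta>: "\<And>a u. a \<in> \<A> \<Longrightarrow> u \<in> Hom K a x \<Longrightarrow> \<theta> a u \<in> Hom K a y"
    and natural: "\<And>a b f u. a \<in> \<A> \<Longrightarrow> b \<in> \<A> \<Longrightarrow> f \<in> Hom K a b \<Longrightarrow> u \<in> Hom K b x \<Longrightarrow>
      \<theta> a (Comp K u f) = Comp K (\<theta> b u) f"
  obtains h where "h \<in> Hom K x y" "\<And>a u. a \<in> \<A> \<Longrightarrow> u \<in> Hom K a x \<Longrightarrow> Comp K h u = \<theta> a u"
proof -
  obtain I :: "'u set" and r D t where *: "small I" "directed_poset I r" "cat_functor (poset_cat I r) K D"
    "\<And>i. i \<in> I \<Longrightarrow> omap D i \<in> \<A>" "is_colimit (poset_cat I r) K D x t"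
    using presentation[OF x] by metis
  have r: "i \<in> I \<and> j \<in> I" if "(i, j) \<in> r" for i j using that directed_posetD(3)[OF *(2)] by auto
  obtain h where h: "h \<in> Hom K x y" "\<And>i. i \<in> I \<Longrightarrow> Comp K h (t i) = \<theta> (omap D i) (t i)"
  proof (rule colimit_factor[OF *(5) y])
    show "\<theta> (omap D i) (t i) \<in> Hom K (omap D i) y" if "i \<in> I" for i
      using \<theta> *(4) colimit_leg[OF *(5)] that by blast
    show "Comp K (\<theta> (omap D j) (t j)) (amap D (i, j)) = \<theta> (omap D i) (t i)" if "(i, j) \<in> r" for i j
      using natural[of "omap D i" "omap D j" "amap D (i, j)" "t j"] *(4) r[OF that]
        poset_functorD(2)[OF *(3) that] colimit_leg[OF *(5)] colimit_compat[OF *(5) that] by simp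
  qed (use that in blast)
  show thesis
  proof (rule that[OF h(1)])
    fix a u assume a: "a \<in> \<A>" and u: "u \<in> Hom K a x"
    obtain i w where i: "i \<in> I" and w: "w \<in> Hom K a (omap D i)" "Comp K (t i) w = u"
      using presentable_factor_universe[OF presentable[OF a] *(1,2,3,5) u] by blast
    have "Comp K h u = Comp K (Comp K h (t i)) w"
      using Comp_assoc[OF w(1) colimit_leg[OF *(5) i] h(1)] w(2) by simp
    also have "\<dots> = \<theta> a u"
      using natural[OF a *(4)[OF i] w(1) colimit_leg[OF *(5) i]] h(2)[OF i] w(2) by simp
    finally show "Comp K h u = \<theta> a u" .
  qed
qed

lemma isomorphicI:
  assumes x: "x \<in> Obj K" and y: "y \<in> Obj K"
    and bij: "\<And>a. a \<in> \<A> \<Longrightarrow> bij_betw (\<theta> a) (Hom K a x) (Hom K a y)"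
    and natural: "\<And>a b f u. a \<in> \<A> \<Longrightarrow> b \<in> \<A> \<Longrightarrow> f \<in> Hom K a b \<Longrightarrow> u \<in> Hom K b x \<Longrightarrow>
      \<theta> a (Comp K u f) = Comp K (\<theta> b u) f"
  shows "isomorphic K x y"
proof -
  define \<eta> where "\<eta> a = inv_into (Hom K a x) (\<theta> a)" for a
  have \<theta>: "\<theta> a u \<in> Hom K a y" "\<eta> a (\<theta> a u) = u" if "a \<in> \<A>" "u \<in> Hom K a x" for a u
    using bij[OF that(1)] that(2) unfolding \<eta>_def by (auto simp: bij_betw_def)
  have \<eta>: "\<eta> a v \<in> Hom K a x" "\<theta> a (\<eta> a v) = v" if "a \<in> \<A>" "v \<in> Hom K a y" for a v
    using bij[OF that(1)] that(2) unfolding \<eta>_def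
    by (auto simp: bij_betw_def inv_into_into f_inv_into_f)
  obtain h where h: "h \<in> Hom K x y" "\<And>a u. a \<in> \<A> \<Longrightarrow> u \<in> Hom K a x \<Longrightarrow> Comp K h u = \<theta> a u"
    using Hom_induced[OF x y, of \<theta>] \<theta>(1) natural by blast
  obtain k where k: "k \<in> Hom K y x" "\<And>a v. a \<in> \<A> \<Longrightarrow> v \<in> Hom K a y \<Longrightarrow> Comp K k v = \<eta> a v"
  proof (rule Hom_induced[OF y x, of \<eta>])
    fix a b f v assume *: "a \<in> \<A>" "b \<in> \<A>" "f \<in> Hom K a b" "v \<in> Hom K b y"
    have "Comp K v f = \<theta> a (Comp K (\<eta> b v) f)"
      using natural[OF *(1-3) \<eta>(1)[OF *(2,4)]] \<eta>(2)[OF *(2,4)] by simp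
    then show "\<eta> a (Comp K v f) = Comp K (\<eta> b v) f"
      using \<theta>(2)[OF *(1) Comp_in_Hom[OF *(3) \<eta>(1)[OF *(2,4)]]] by simp
  qed (use \<eta>(1) that in auto)
  have "Comp K k h = Ide K x"
  proof (rule Hom_eqI[OF Comp_in_Hom[OF h(1) k(1)] Ide_in_Hom[OF x]])
    fix a u assume "a \<in> \<A>" "u \<in> Hom K a x"
    then show "Comp K (Comp K k h) u = Comp K (Ide K x) u"
      using Comp_assoc[OF _ h(1) k(1)] h(2) k(2) \<theta> Ide_Comp by metis
  qed
  moreover have "Comp K h k = Ide K y"
  proof (rule Hom_eqI[OF Comp_in_Hom[OF k(1) h(1)] Ide_in_Hom[OF y]])
    fix a v assume "a \<in> \<A>" "v \<in> Hom K a y"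
    then show "Comp K (Comp K h k) v = Comp K (Ide K y) v"
      using Comp_assoc[OF _ k(1) h(1)] h(2) k(2) \<eta> Ide_Comp by metis
  qed
  ultimately show ?thesis using h(1) k(1) unfolding isomorphic_def by blast
qed

lemma small_\<A>_arrows: "small (\<Union>a\<in>\<A>. \<Union>b\<in>\<A>. Hom K a b)"
proof -
  have "small_for TYPE('u) (\<Union>a\<in>\<A>. \<Union>b\<in>\<A>. Hom K a b)"
    using small_\<A> small_Hom \<A>_Obj
    by (intro small_for_UN[OF inacc]) (auto simp: small_for_small)
  then show ?thesis by (simp add: small_for_small)
qed

text \<open>
  If the sets \<open>Hom(a, M)\<close> were all smaller than \<open>S\<close>, then the presheaf \<open>Hom(-, M)\<close> on \<open>\<A>\<close> could be copied
  onto subsets of \<open>S\<close>. There is only a small set of such copies, and \<open>M\<close> is determined up to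
  isomorphism by its copy, so \<open>K\<close> would not be large.
\<close>

lemma large_Hom:
  fixes S :: "'u set"
  assumes large: "large K" and S: "small S"
  obtains a M where "a \<in> \<A>" "M \<in> Obj K" "|S| \<le>o |Hom K a M|"
proof (rule ccontr)
  note found = that
  assume no: "\<not> thesis"
  have "\<exists>j. inj_on j (Hom K a M) \<and> j ` Hom K a M \<subseteq> S" if aM: "a \<in> \<A>" "M \<in> Obj K" for a M
  proof -
    have "\<not> |S| \<le>o |Hom K a M|" using found[of a M] aM no by blast
    then have "|Hom K a M| \<le>o |S|" using ordLeq_total ordLess_imp_ordLeq by blast
    then show ?thesis using card_of_ordLeq by blast
  qed
  then obtain j where j: "\<And>a M. a \<in> \<A> \<Longrightarrow> M \<in> Obj K \<Longrightarrow> inj_on (j a M) (Hom K a M)"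
    "\<And>a M u. a \<in> \<A> \<Longrightarrow> M \<in> Obj K \<Longrightarrow> u \<in> Hom K a M \<Longrightarrow> j a M u \<in> S"
    by (metis image_subset_iff)
  \<comment> \<open>The presheaf \<open>Hom(-, M)\<close> on \<open>\<A>\<close>, transported along these injections.\<close>
  define code where "code M = {(f, j b M u, j a M (Comp K u f)) |a b f u.
      a \<in> \<A> \<and> b \<in> \<A> \<and> f \<in> Hom K a b \<and> u \<in> Hom K b M}" for M
  have iso: "isomorphic K M N" if MN: "M \<in> Obj K" "N \<in> Obj K" "code M = code N" for M N
  proof -
    have transfer: "\<exists>v\<in>Hom K b N. j b M u = j b N v \<and> j a M (Comp K u f) = j a N (Comp K v f)"
      if "M \<in> Obj K" "N \<in> Obj K" "code M = code N" "a \<in> \<A>" "b \<in> \<A>" "f \<in> Hom K a b" "u \<in> Hom K b M"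
      for M N a b f u
    proof -
      have "(f, j b M u, j a M (Comp K u f)) \<in> code N"
        using that unfolding code_def by blast
      then obtain a' b' v where *: "f \<in> Hom K a' b'" "v \<in> Hom K b' N" "j b M u = j b' N v"
        "j a M (Comp K u f) = j a' N (Comp K v f)" unfolding code_def by auto
      moreover have "a' = a" "b' = b" using HomD[OF *(1)] HomD[OF that(6)] by auto
      ultimately show ?thesis by blast
    qed
    define \<theta> where "\<theta> a u = inv_into (Hom K a N) (j a N) (j a M u)" for a u
    have \<theta>: "\<theta> b u \<in> Hom K b N \<and> j b N (\<theta> b u) = j b M u \<and> \<theta> a (Comp K u f) = Comp K (\<theta> b u) f"
      if *: "a \<in> \<A>" "b \<in> \<A>" "f \<in> Hom K a b" "u \<in> Hom K b M" for a b f u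
    proof -
      obtain v where v: "v \<in> Hom K b N" "j b M u = j b N v" "j a M (Comp K u f) = j a N (Comp K v f)"
        using transfer[OF MN *] by blast
      have "\<theta> b u = v" unfolding \<theta>_def v(2) using j(1)[OF *(2) MN(2)] v(1) by simp
      moreover have "\<theta> a (Comp K u f) = Comp K v f"
        unfolding \<theta>_def v(3) using j(1)[OF *(1) MN(2)] Comp_in_Hom[OF *(3) v(1)] by simp
      ultimately show ?thesis using v by simp
    qed
    show ?thesis
    proof (rule isomorphicI[OF MN(1,2)])
      show "\<theta> a (Comp K u f) = Comp K (\<theta> b u) f"
        if "a \<in> \<A>" "b \<in> \<A>" "f \<in> Hom K a b" "u \<in> Hom K b M" for a b f u
        using \<theta>[OF that] by blast
      fix a assume a: "a \<in> \<A>"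
      note id = Ide_in_Hom[OF \<A>_Obj[OF a]]
      show "bij_betw (\<theta> a) (Hom K a M) (Hom K a N)"
        unfolding bij_betw_def
      proof
        show "inj_on (\<theta> a) (Hom K a M)"
          using \<theta>[OF a a id] inj_onD[OF j(1)[OF a MN(1)]] by (metis inj_onI)
        show "\<theta> a ` Hom K a M = Hom K a N"
        proof
          show "\<theta> a ` Hom K a M \<subseteq> Hom K a N" using \<theta>[OF a a id] by blast
          show "Hom K a N \<subseteq> \<theta> a ` Hom K a M"
          proof
            fix v assume v: "v \<in> Hom K a N"
            obtain u where u: "u \<in> Hom K a M" "j a N v = j a M u"
              using transfer[OF MN(2,1) MN(3)[symmetric] a a id v] by blast
            then have "\<theta> a u = v" using \<theta>[OF a a id u(1)] inj_onD[OF j(1)[OF a MN(2)]] v by metis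
            then show "v \<in> \<theta> a ` Hom K a M" using u(1) by blast
          qed
        qed
      qed
    qed
  qed
  define rep where "rep c = (SOME M. M \<in> Obj K \<and> code M = c)" for c
  have rep: "rep (code M) \<in> Obj K" "code (rep (code M)) = code M" if "M \<in> Obj K" for M
    using someI[of "\<lambda>N. N \<in> Obj K \<and> code N = code M" M] that by (auto simp: rep_def)
  have "code M \<subseteq> (\<Union>a\<in>\<A>. \<Union>b\<in>\<A>. Hom K a b) \<times> S \<times> S" if M: "M \<in> Obj K" for M
  proof
    fix z assume "z \<in> code M"
    then obtain a b f u where z: "z = (f, j b M u, j a M (Comp K u f))"
      and *: "a \<in> \<A>" "b \<in> \<A>" "f \<in> Hom K a b" "u \<in> Hom K b M" unfolding code_def by auto
    have "j b M u \<in> S" "j a M (Comp K u f) \<in> S"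
      using j(2) M * Comp_in_Hom[OF *(3,4)] by blast+
    then show "z \<in> (\<Union>a\<in>\<A>. \<Union>b\<in>\<A>. Hom K a b) \<times> S \<times> S" using z * by blast
  qed
  then have "code ` Obj K \<subseteq> Pow ((\<Union>a\<in>\<A>. \<Union>b\<in>\<A>. Hom K a b) \<times> S \<times> S)" by blast
  moreover have "small_for TYPE('u) (Pow ((\<Union>a\<in>\<A>. \<Union>b\<in>\<A>. Hom K a b) \<times> S \<times> S))"
    using small_\<A>_arrows S
    by (intro small_for_Pow[OF inacc] small_for_Times[OF inacc]) (auto simp: small_for_small)
  ultimately have "small_for TYPE('u) (rep ` code ` Obj K)"
    using small_for_subset small_for_image by metis
  then have "small (rep ` code ` Obj K)" by (simp add: small_for_small)
  moreover have "rep ` code ` Obj K \<subseteq> Obj K" using rep(1) by blast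
  moreover have "\<forall>x\<in>Obj K. \<exists>y\<in>rep ` code ` Obj K. isomorphic K x y"
  proof
    fix x assume x: "x \<in> Obj K"
    have "isomorphic K x (rep (code x))" using rep[OF x] x by (intro iso) auto
    then show "\<exists>y\<in>rep ` code ` Obj K. isomorphic K x y" using x by blast
  qed
  ultimately show False using large unfolding large_def by blast
qed

end


section \<open>Finite linear orders\<close>

definition order_embedding_on :: "'x set \<Rightarrow> 'x rel \<Rightarrow> 'y rel \<Rightarrow> ('x \<Rightarrow> 'y) \<Rightarrow> bool" where
  "order_embedding_on s r r' f \<longleftrightarrow>
     inj_on f s \<and> (\<forall>y\<in>s. \<forall>z\<in>s. (y, z) \<in> r \<longleftrightarrow> (f y, f z) \<in> r')"

lemma order_embedding_on_subset:
  "order_embedding_on s r r' f \<Longrightarrow> s' \<subseteq> s \<Longrightarrow> order_embedding_on s' r r' f"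
  unfolding order_embedding_on_def using inj_on_subset by blast

text \<open>
  Ranks describe the position of a subset within a finite linear order by a set of natural
  numbers, so that positions in different orders can be compared.
\<close>

definition rank :: "'x rel \<Rightarrow> 'x set \<Rightarrow> 'x \<Rightarrow> nat" where
  "rank r s y = card {z \<in> s. (z, y) \<in> r \<and> z \<noteq> y}"

lemma rank_embedding:
  assumes f: "order_embedding_on s r r' f" and y: "y \<in> s"
  shows "rank r' (f ` s) (f y) = rank r s y"
proof -
  have "{z \<in> f ` s. (z, f y) \<in> r' \<and> z \<noteq> f y} = f ` {z \<in> s. (z, y) \<in> r \<and> z \<noteq> y}"
    using f y unfolding order_embedding_on_def by (auto dest: inj_onD)
  moreover have "inj_on f {z \<in> s. (z, y) \<in> r \<and> z \<noteq> y}"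
    using f unfolding order_embedding_on_def by (auto intro: inj_on_subset)
  ultimately show ?thesis by (simp add: rank_def card_image)
qed

lemma linear_orderD:
  assumes "linear_order_on Y r"
  shows "y \<in> Y \<Longrightarrow> (y, y) \<in> r" "y \<in> Y \<Longrightarrow> z \<in> Y \<Longrightarrow> (y, z) \<in> r \<or> (z, y) \<in> r"
    "(x, y) \<in> r \<Longrightarrow> (y, z) \<in> r \<Longrightarrow> (x, z) \<in> r" "(y, z) \<in> r \<Longrightarrow> (z, y) \<in> r \<Longrightarrow> y = z"
proof -
  have refl: "refl_on Y r" and "total_on Y r" "trans r" "antisym r"
    using assms by (auto simp: order_on_defs)
  then show "y \<in> Y \<Longrightarrow> (y, y) \<in> r" "(x, y) \<in> r \<Longrightarrow> (y, z) \<in> r \<Longrightarrow> (x, z) \<in> r"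
    "(y, z) \<in> r \<Longrightarrow> (z, y) \<in> r \<Longrightarrow> y = z"
    by (auto simp: refl_on_def dest: transD antisymD)
  show "y \<in> Y \<Longrightarrow> z \<in> Y \<Longrightarrow> (y, z) \<in> r \<or> (z, y) \<in> r"
    using refl \<open>total_on Y r\<close> by (cases "y = z") (auto simp: refl_on_def total_on_def)
qed

lemma rank_less:
  assumes r: "linear_order_on Y r" and s: "s \<subseteq> Y" "finite s"
    and yz: "y \<in> s" "z \<in> s" "(y, z) \<in> r" "y \<noteq> z"
  shows "rank r s y < rank r s z"
  unfolding rank_def
proof (rule psubset_card_mono)
  show "finite {x \<in> s. (x, z) \<in> r \<and> x \<noteq> z}" using s by simp
  show "{x \<in> s. (x, y) \<in> r \<and> x \<noteq> y} \<subset> {x \<in> s. (x, z) \<in> r \<and> x \<noteq> z}"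
    using yz linear_orderD(3,4)[OF r] by blast
qed

lemma rank_le_iff:
  assumes r: "linear_order_on Y r" and s: "s \<subseteq> Y" "finite s" and yz: "y \<in> s" "z \<in> s"
  shows "(y, z) \<in> r \<longleftrightarrow> rank r s y \<le> rank r s z"
proof (cases "y = z")
  case True
  then show ?thesis using linear_orderD(1)[OF r] s yz by auto
next
  case False
  then show ?thesis
    using rank_less[OF r s yz] rank_less[OF r s yz(2,1)] linear_orderD(2)[OF r, of y z] s yz
    by (auto simp: subset_iff)
qed

lemma bij_betw_rank:
  assumes r: "linear_order_on Y r" and s: "s \<subseteq> Y" "finite s"
  shows "bij_betw (rank r s) s {..<card s}"
proof -
  have inj: "inj_on (rank r s) s"
  proof (rule inj_onI)
    fix y z assume yz: "y \<in> s" "z \<in> s" "rank r s y = rank r s z"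
    then have "(y, z) \<in> r" "(z, y) \<in> r" using rank_le_iff[OF r s] by simp_all
    then show "y = z" using linear_orderD(4)[OF r] by blast
  qed
  have "rank r s y < card s" if "y \<in> s" for y
    unfolding rank_def using that s(2) by (intro psubset_card_mono) auto
  then have "rank r s ` s \<subseteq> {..<card s}" by auto
  moreover have "card (rank r s ` s) = card {..<card s}" using inj by (simp add: card_image)
  ultimately have "rank r s ` s = {..<card s}" by (intro card_subset_eq) auto
  then show ?thesis using inj by (simp add: bij_betw_def)
qed

lemma finite_linear_orders_isomorphic:
  assumes r: "linear_order_on Y r" "s \<subseteq> Y" "finite s"
    and r': "linear_order_on Y' r'" "s' \<subseteq> Y'" "finite s'" and card: "card s = card s'"
  obtains f where "order_embedding_on s r r' f" "f ` s = s'"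
proof -
  define f where "f = inv_into s' (rank r' s') \<circ> rank r s"
  have "bij_betw (inv_into s' (rank r' s')) {..<card s} s'"
    using bij_betw_inv_into[OF bij_betw_rank[OF r']] card by simp
  then have bij: "bij_betw f s s'"
    unfolding f_def using bij_betw_rank[OF r] bij_betw_trans by blast
  have rank_f: "rank r' s' (f y) = rank r s y" if "y \<in> s" for y
  proof -
    have "rank r s y \<in> rank r' s' ` s'"
      using bij_betw_rank[OF r] bij_betw_rank[OF r'] card that by (auto simp: bij_betw_def)
    then show ?thesis unfolding f_def by (simp add: f_inv_into_f)
  qed
  have "(y, z) \<in> r \<longleftrightarrow> (f y, f z) \<in> r'" if "y \<in> s" "z \<in> s" for y z
    using rank_le_iff[OF r that] rank_le_iff[OF r', of "f y" "f z"] rank_f that bij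
    by (auto simp: bij_betw_def)
  then have "order_embedding_on s r r' f"
    using bij by (simp add: order_embedding_on_def bij_betw_def)
  then show thesis using bij that by (auto simp: bij_betw_def)
qed


section \<open>Indiscernibles\<close>

context accessible_presentation
begin

text \<open>
  A functor from the finite subsets of \<open>X\<close> to \<open>\<A>\<close>, with transition arrows \<open>\<gamma> s' s\<close>, in which every
  point \<open>x\<close> of \<open>X\<close> is represented by a generalized element \<open>e x\<close> of shape \<open>a\<close>, and different points
  are not identified at any stage. This is all that is kept of an object \<open>M\<close> with \<open>X = Hom(a, M)\<close>.
\<close>

definition realization ::
    "'u set \<Rightarrow> 'u \<Rightarrow> ('u set \<Rightarrow> 'u) \<Rightarrow> ('u set \<Rightarrow> 'u set \<Rightarrow> 'u) \<Rightarrow> ('u \<Rightarrow> 'u) \<Rightarrow> bool" where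
  "realization X a G \<gamma> e \<longleftrightarrow> a \<in> \<A> \<and>
     (\<forall>s. finite s \<and> s \<subseteq> X \<longrightarrow> G s \<in> \<A> \<and> \<gamma> s s = Ide K (G s) \<and>
       (\<forall>s'\<subseteq>s. \<gamma> s' s \<in> Hom K (G s') (G s) \<and>
         (\<forall>s''\<subseteq>s'. \<gamma> s'' s = Comp K (\<gamma> s' s) (\<gamma> s'' s')))) \<and>
     (\<forall>x\<in>X. e x \<in> Hom K a (G {x})) \<and>
     (\<forall>s. finite s \<and> s \<subseteq> X \<longrightarrow>
       (\<forall>x\<in>s. \<forall>y\<in>s. x \<noteq> y \<longrightarrow> Comp K (\<gamma> {x} s) (e x) \<noteq> Comp K (\<gamma> {y} s) (e y)))"

lemma realizationD:
  assumes "realization X a G \<gamma> e" "finite s" "s \<subseteq> X"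
  shows "G s \<in> \<A>" "\<gamma> s s = Ide K (G s)" "s' \<subseteq> s \<Longrightarrow> \<gamma> s' s \<in> Hom K (G s') (G s)"
    "s' \<subseteq> s \<Longrightarrow> s'' \<subseteq> s' \<Longrightarrow> \<gamma> s'' s = Comp K (\<gamma> s' s) (\<gamma> s'' s')"
    "x \<in> s \<Longrightarrow> y \<in> s \<Longrightarrow> x \<noteq> y \<Longrightarrow> Comp K (\<gamma> {x} s) (e x) \<noteq> Comp K (\<gamma> {y} s) (e y)"
  using assms unfolding realization_def by metis+

lemma realizationD2:
  assumes "realization X a G \<gamma> e"
  shows "a \<in> \<A>" "x \<in> X \<Longrightarrow> e x \<in> Hom K a (G {x})"
  using assms unfolding realization_def by metis+

text \<open>
  Recursion along strict inclusion: a finite set has only finitely many proper subsets, so the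
  values that have to be bounded form a finite set.
\<close>

lemma directed_monotone_choice:
  fixes X :: "'x set" and I :: "'i set"
  assumes dir: "directed_poset I r" and i: "\<And>x. x \<in> X \<Longrightarrow> i x \<in> I"
  obtains g where "\<And>s. finite s \<Longrightarrow> s \<subseteq> X \<Longrightarrow> g s \<in> I"
    "\<And>s s'. finite s \<Longrightarrow> s \<subseteq> X \<Longrightarrow> s' \<subseteq> s \<Longrightarrow> (g s', g s) \<in> r"
    "\<And>s x. finite s \<Longrightarrow> s \<subseteq> X \<Longrightarrow> x \<in> s \<Longrightarrow> (i x, g s) \<in> r"
proof -
  have "\<exists>g. \<forall>s. finite s \<and> s \<subseteq> X \<longrightarrow> g s \<in> I \<and> (\<forall>x\<in>s. (i x, g s) \<in> r) \<and> (\<forall>s'\<subset>s. (g s', g s) \<in> r)"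
  proof (rule dependent_wf_choice[OF wf_finite_psubset])
    fix f g :: "'x set \<Rightarrow> 'i" and s k
    assume eq: "\<And>z. (z, s) \<in> finite_psubset \<Longrightarrow> f z = g z"
    then have "f s' = g s'" if "finite s" "s' \<subset> s" for s'
      using that by (simp add: finite_psubset_def)
    then show "(finite s \<and> s \<subseteq> X \<longrightarrow> k \<in> I \<and> (\<forall>x\<in>s. (i x, k) \<in> r) \<and> (\<forall>s'\<subset>s. (f s', k) \<in> r)) =
        (finite s \<and> s \<subseteq> X \<longrightarrow> k \<in> I \<and> (\<forall>x\<in>s. (i x, k) \<in> r) \<and> (\<forall>s'\<subset>s. (g s', k) \<in> r))"
      by auto
  next
    fix s and f :: "'x set \<Rightarrow> 'i"
    assume IH: "\<And>y. (y, s) \<in> finite_psubset \<Longrightarrow>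
      finite y \<and> y \<subseteq> X \<longrightarrow> f y \<in> I \<and> (\<forall>x\<in>y. (i x, f y) \<in> r) \<and> (\<forall>s'\<subset>y. (f s', f y) \<in> r)"
    show "\<exists>k. finite s \<and> s \<subseteq> X \<longrightarrow> k \<in> I \<and> (\<forall>x\<in>s. (i x, k) \<in> r) \<and> (\<forall>s'\<subset>s. (f s', k) \<in> r)"
    proof (cases "finite s \<and> s \<subseteq> X")
      case True
      then have "f s' \<in> I" if "s' \<subset> s" for s'
        using IH[of s'] that finite_subset[of s' s] by (auto simp: finite_psubset_def)
      then have "i ` s \<union> f ` {s'. s' \<subset> s} \<subseteq> I" using i True by auto
      moreover have "finite {s'. s' \<subset> s}"
        using True by (auto intro: finite_subset[of _ "Pow s"])
      then have "finite (i ` s \<union> f ` {s'. s' \<subset> s})" using True by simp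
      ultimately obtain k where "k \<in> I" "\<And>j. j \<in> i ` s \<union> f ` {s'. s' \<subset> s} \<Longrightarrow> (j, k) \<in> r"
        using directed_poset_finite_bound[OF dir] by metis
      then show ?thesis by blast
    qed blast
  qed
  then obtain g where "\<forall>s. finite s \<and> s \<subseteq> X \<longrightarrow>
      g s \<in> I \<and> (\<forall>x\<in>s. (i x, g s) \<in> r) \<and> (\<forall>s'\<subset>s. (g s', g s) \<in> r)" by (rule exE)
  then have g: "g s \<in> I \<and> (\<forall>x\<in>s. (i x, g s) \<in> r) \<and> (\<forall>s'\<subset>s. (g s', g s) \<in> r)"
    if "finite s" "s \<subseteq> X" for s using that by simp
  have "(g s', g s) \<in> r" if "finite s" "s \<subseteq> X" "s' \<subseteq> s" for s s'
    using g[OF that(1,2)] that(3) directed_posetD(4)[OF dir] by (cases "s' = s") auto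
  then show thesis using g by (intro that[of g]) auto
qed

text \<open>
  A presentation of \<open>M\<close> is pulled back along a monotone choice of indices. The points stay distinct
  since composing with the leg at stage \<open>s\<close> turns the image of \<open>e x\<close> into \<open>x\<close> itself.
\<close>

lemma realization_of_Hom:
  assumes a: "a \<in> \<A>" and M: "M \<in> Obj K"
  obtains G \<gamma> e where "realization (Hom K a M) a G \<gamma> e"
proof -
  let ?X = "Hom K a M"
  obtain I :: "'u set" and r D t where *: "small I" "directed_poset I r" "cat_functor (poset_cat I r) K D"
    "\<And>i. i \<in> I \<Longrightarrow> omap D i \<in> \<A>" "is_colimit (poset_cat I r) K D M t"
    using presentation[OF M] by metis
  note D = poset_functorD[OF *(3)]
  have "\<exists>i u. i \<in> I \<and> u \<in> Hom K a (omap D i) \<and> Comp K (t i) u = x" if "x \<in> ?X" for x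
    using presentable_factor_universe[OF presentable[OF a] *(1,2,3,5) that] by blast
  then obtain i u where iu: "\<And>x. x \<in> ?X \<Longrightarrow> i x \<in> I" "\<And>x. x \<in> ?X \<Longrightarrow> u x \<in> Hom K a (omap D (i x))"
    "\<And>x. x \<in> ?X \<Longrightarrow> Comp K (t (i x)) (u x) = x" by metis
  obtain g where g: "\<And>s. finite s \<Longrightarrow> s \<subseteq> ?X \<Longrightarrow> g s \<in> I"
    "\<And>s s'. finite s \<Longrightarrow> s \<subseteq> ?X \<Longrightarrow> s' \<subseteq> s \<Longrightarrow> (g s', g s) \<in> r"
    "\<And>s x. finite s \<Longrightarrow> s \<subseteq> ?X \<Longrightarrow> x \<in> s \<Longrightarrow> (i x, g s) \<in> r"
    using directed_monotone_choice[OF *(2), of ?X i] iu(1) by blast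
  define G where "G s = omap D (g s)" for s
  define \<gamma> where "\<gamma> s' s = amap D (g s', g s)" for s' s
  define e where "e x = Comp K (amap D (i x, g {x})) (u x)" for x
  have ig: "(i x, g {x}) \<in> r" if "x \<in> ?X" for x using g(3)[of "{x}" x] that by simp
  have e: "e x \<in> Hom K a (G {x})" if "x \<in> ?X" for x
    unfolding e_def G_def using Comp_in_Hom[OF iu(2)[OF that] D(2)[OF ig[OF that]]] .
  have x: "Comp K (t (g s)) (Comp K (\<gamma> {x} s) (e x)) = x" if s: "finite s" "s \<subseteq> ?X" "x \<in> s" for s x
  proof -
    have xX: "x \<in> ?X" and sub: "{x} \<subseteq> s" using s by auto
    have gg: "(g {x}, g s) \<in> r" using g(2)[OF s(1,2) sub] .
    have leg: "t (g s) \<in> Hom K (omap D (g s)) M" "t (g {x}) \<in> Hom K (omap D (g {x})) M"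
      using colimit_leg[OF *(5)] g(1) s(1,2) xX by auto
    have "Comp K (t (g s)) (Comp K (\<gamma> {x} s) (e x)) = Comp K (t (g {x})) (e x)"
      using Comp_assoc[OF e[OF xX, unfolded G_def] D(2)[OF gg] leg(1)]
        colimit_compat[OF *(5) gg] by (simp add: \<gamma>_def)
    also have "\<dots> = Comp K (t (i x)) (u x)"
      using Comp_assoc[OF iu(2)[OF xX] D(2)[OF ig[OF xX]] leg(2)]
        colimit_compat[OF *(5) ig[OF xX]] by (simp add: e_def)
    finally show ?thesis using iu(3)[OF xX] by simp
  qed
  have "realization ?X a G \<gamma> e"
    unfolding realization_def
  proof (intro conjI allI impI ballI)
    show "a \<in> \<A>" by (rule a)
    show "e x \<in> Hom K a (G {x})" if "x \<in> ?X" for x using e[OF that] .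
    fix s assume s: "finite s \<and> s \<subseteq> ?X"
    show "G s \<in> \<A>" using *(4) g(1) s by (simp add: G_def)
    show "\<gamma> s s = Ide K (G s)" using D(3) g(1) s by (simp add: \<gamma>_def G_def)
    show "\<gamma> s' s \<in> Hom K (G s') (G s)" if "s' \<subseteq> s" for s'
      using D(2) g(2)[of s s'] s that by (simp add: \<gamma>_def G_def)
    show "\<gamma> s'' s = Comp K (\<gamma> s' s) (\<gamma> s'' s')" if "s' \<subseteq> s" "s'' \<subseteq> s'" for s' s''
    proof -
      have "finite s'" "s' \<subseteq> ?X" using s that finite_subset by auto
      then show ?thesis using D(4)[OF g(2)[of s' s''] g(2)[of s s']] s that by (simp add: \<gamma>_def)
    qed
    show "Comp K (\<gamma> {x} s) (e x) \<noteq> Comp K (\<gamma> {y} s) (e y)" if "x \<in> s" "y \<in> s" "x \<noteq> y" for x y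
      using x[of s] s that by metis
  qed
  then show thesis by (rule that)
qed

text \<open>
  The colour records all arrows of the functor into \<open>s\<close>, each labelled with the position of
  its source in \<open>s\<close>. For singletons it records in addition the representing element, so that on a
  homogeneous set all points are represented by the same arrow.
\<close>

definition colour :: "'u rel \<Rightarrow> ('u set \<Rightarrow> 'u set \<Rightarrow> 'u) \<Rightarrow> ('u \<Rightarrow> 'u) \<Rightarrow> 'u set \<Rightarrow> (nat set \<Rightarrow> 'u) \<times> 'u" where
  "colour w \<gamma> e s = (\<lambda>P\<in>Pow {..<card s}. \<gamma> {x \<in> s. rank w s x \<in> P} s,
     if card s = 1 then e (the_elem s) else undefined)"

lemma colour_image_rank:
  assumes "linear_order_on Y w" "finite s" "s \<subseteq> Y" "s' \<subseteq> s"
  shows "fst (colour w \<gamma> e s) (rank w s ` s') = \<gamma> s' s"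
proof -
  have bij: "bij_betw (rank w s) s {..<card s}" using bij_betw_rank assms by blast
  then have "rank w s ` s' \<in> Pow {..<card s}" using assms(4) by (auto simp: bij_betw_def)
  moreover have "{x \<in> s. rank w s x \<in> rank w s ` s'} = s'"
    using bij assms(4) by (auto simp: bij_betw_def dest: inj_onD)
  ultimately show ?thesis by (simp add: colour_def)
qed

lemma coherent_realizations:
  assumes large: "large K" and w: "linear_order_on (UNIV :: 'u set) w"
  obtains p where "\<And>n. \<exists>X a G \<gamma> e s. realization X a G \<gamma> e \<and> s \<subseteq> X \<and> finite s \<and> card s = n \<and>
    (\<forall>s'\<subseteq>s. colour w \<gamma> e s' = p (card s'))"
proof -
  define R where "R = {(X, colour w \<gamma> e) |X a G \<gamma> e. realization X a G \<gamma> e}"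
  let ?A = "\<Union>a\<in>\<A>. \<Union>b\<in>\<A>. Hom K a b"
  define T where "T n = (Pow {..<n} \<rightarrow>\<^sub>E ?A) \<times> insert undefined ?A" for n :: nat
  have small_A: "small_for TYPE('u) ?A" using small_\<A>_arrows by (simp add: small_for_small)
  have small_A': "small_for TYPE('u) (insert undefined ?A)"
  proof -
    have "insert undefined ?A = (\<Union>b\<in>UNIV. if b then {undefined} else ?A)" by (auto split: if_splits)
    moreover have "small_for TYPE('u) \<dots>"
      using small_A by (intro small_for_UN[OF inacc]) (auto intro: small_for_finite[OF inacc])
    ultimately show ?thesis by simp
  qed
  have small_T: "small_for TYPE('u) (T n)" for n
    unfolding T_def
    by (intro small_for_Times[OF inacc] small_for_PiE[OF inacc] small_A small_A' small_for_finite[OF inacc]) simp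
  have colours: "c s \<in> T (card s)" if "(X, c) \<in> R" "s \<subseteq> X" "finite s" for X c s
  proof -
    from that(1) obtain a G \<gamma> e where re: "realization X a G \<gamma> e" and c: "c = colour w \<gamma> e"
      by (auto simp: R_def)
    note re_s = realizationD[OF re that(3,2)]
    have "\<gamma> s' s \<in> ?A" if "s' \<subseteq> s" for s'
    proof -
      have "G s' \<in> \<A>" using realizationD(1)[OF re, of s'] that \<open>s \<subseteq> X\<close> \<open>finite s\<close> finite_subset by blast
      then show ?thesis using re_s(1) re_s(3)[OF that] by blast
    qed
    moreover have "e (the_elem s) \<in> ?A" if "card s = 1"
    proof -
      obtain x where "s = {x}" using \<open>card s = 1\<close> card_1_singletonE by blast
      then show ?thesis using re_s(1) realizationD2[OF re] \<open>s \<subseteq> X\<close> by auto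
    qed
    ultimately show ?thesis unfolding c T_def colour_def by auto
  qed
  have unbounded: "\<exists>(X, c)\<in>R. |S| \<le>o |X|" if "small S" for S :: "'u set"
  proof -
    obtain a M where aM: "a \<in> \<A>" "M \<in> Obj K" "|S| \<le>o |Hom K a M|"
      by (rule large_Hom[OF large \<open>small S\<close>])
    obtain G \<gamma> e where "realization (Hom K a M) a G \<gamma> e" using realization_of_Hom[OF aM(1,2)] .
    then have "(Hom K a M, colour w \<gamma> e) \<in> R" unfolding R_def by blast
    then show ?thesis using aM(3) by blast
  qed
  obtain p where p: "\<And>n. \<exists>(X, c)\<in>R. \<exists>s\<subseteq>X. finite s \<and> card s = n \<and> (\<forall>s'\<subseteq>s. c s' = p (card s'))"
    using coherent_colours[OF inacc, where R = R and T = T] small_T colours unbounded by blast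
  have "\<exists>X a G \<gamma> e s. realization X a G \<gamma> e \<and> s \<subseteq> X \<and> finite s \<and> card s = n \<and>
    (\<forall>s'\<subseteq>s. colour w \<gamma> e s' = p (card s'))" for n
  proof -
    obtain X c s where 1: "(X, c) \<in> R" "s \<subseteq> X" "finite s" "card s = n" "\<forall>s'\<subseteq>s. c s' = p (card s')"
      using p[of n] by auto
    then obtain a G \<gamma> e where "realization X a G \<gamma> e" "c = colour w \<gamma> e" by (auto simp: R_def)
    then show ?thesis using 1 by blast
  qed
  then show thesis by (rule that)
qed

end

text \<open>
  In effect a functor from finite linear orders and embeddings to \<open>K\<close>: on the subsets of a linear
  order \<open>r\<close> it is given by arrows \<open>\<Phi> r s' s\<close>, and \<open>\<Phi>_embedding\<close> expresses that they depend on
  the order type only.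
\<close>

locale order_invariant_diagram = accessible_presentation +
  fixes b :: "nat \<Rightarrow> 'a" and \<Phi> :: "'a rel \<Rightarrow> 'a set \<Rightarrow> 'a set \<Rightarrow> 'a"
  assumes b_presentable: "finitely_presentable K (b n)"
    and \<Phi>_Hom: "linear_order_on Y r \<Longrightarrow> s \<subseteq> Y \<Longrightarrow> finite s \<Longrightarrow> s' \<subseteq> s \<Longrightarrow>
      \<Phi> r s' s \<in> Hom K (b (card s')) (b (card s))"
    and \<Phi>_Ide: "linear_order_on Y r \<Longrightarrow> s \<subseteq> Y \<Longrightarrow> finite s \<Longrightarrow> \<Phi> r s s = Ide K (b (card s))"
    and \<Phi>_Comp: "linear_order_on Y r \<Longrightarrow> s \<subseteq> Y \<Longrightarrow> finite s \<Longrightarrow> s' \<subseteq> s \<Longrightarrow> s'' \<subseteq> s' \<Longrightarrow>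
      \<Phi> r s'' s = Comp K (\<Phi> r s' s) (\<Phi> r s'' s')"
    and \<Phi>_embedding: "order_embedding_on s r r' f \<Longrightarrow> s' \<subseteq> s \<Longrightarrow> \<Phi> r' (f ` s') (f ` s) = \<Phi> r s' s"
    and \<Phi>_points: "linear_order_on Y r \<Longrightarrow> s \<subseteq> Y \<Longrightarrow> finite s \<Longrightarrow> y \<in> s \<Longrightarrow> z \<in> s \<Longrightarrow> y \<noteq> z \<Longrightarrow>
      \<Phi> r {y} s \<noteq> \<Phi> r {z} s"

text \<open>
  The coherent colours are the diagram: \<open>\<Phi> r s' s\<close> is the arrow that the colour for \<open>card s\<close> attaches
  to the position of \<open>s'\<close> in \<open>s\<close>. To verify a law about subsets of \<open>s\<close>, transport \<open>s\<close> along an order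
  isomorphism \<open>\<theta>\<close> to a homogeneous set of the same size in some realization, where \<open>\<Phi>\<close> becomes
  the functor \<open>\<gamma>\<close>.
\<close>

lemma (in accessible_presentation) order_invariant_diagram_exists:
  assumes large: "large K"
  shows "\<exists>b \<Phi>. order_invariant_diagram K \<A> b \<Phi>"
proof -
  obtain w where w: "linear_order_on (UNIV :: 'u set) w"
    using card_of_well_order_on[of "UNIV :: 'u set"] by (auto simp: well_order_on_def)
  obtain p where p: "\<And>n. \<exists>X a G \<gamma> e s. realization X a G \<gamma> e \<and> s \<subseteq> X \<and> finite s \<and> card s = n \<and>
      (\<forall>s'\<subseteq>s. colour w \<gamma> e s' = p (card s'))"
    using coherent_realizations[OF large w] by metis
  define b where "b n = Dom K (fst (p n) {..<n})" for n
  define \<Phi> where "\<Phi> r s' s = fst (p (card s)) (rank r s ` s')" for r s' and s :: "'u set"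
  define e0 where "e0 = snd (p 1)"
  have realize: "\<exists>X a G \<gamma> e S \<theta>. realization X a G \<gamma> e \<and> finite S \<and> S \<subseteq> X \<and>
      order_embedding_on s r w \<theta> \<and> \<theta> ` s = S \<and>
      (\<forall>s'\<subseteq>s. b (card s') = G (\<theta> ` s') \<and> (\<forall>s''\<subseteq>s'. \<Phi> r s'' s' = \<gamma> (\<theta> ` s'') (\<theta> ` s'))) \<and>
      (\<forall>y\<in>s. e (\<theta> y) = e0)"
    if r: "linear_order_on Y r" and s: "s \<subseteq> Y" "finite s" for Y r s
  proof -
    obtain X a G \<gamma> e S where re: "realization X a G \<gamma> e" and S: "S \<subseteq> X" "finite S" "card S = card s"
      and col: "\<And>s'. s' \<subseteq> S \<Longrightarrow> colour w \<gamma> e s' = p (card s')" using p[of "card s"] by auto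
    obtain \<theta> where \<theta>: "order_embedding_on s r w \<theta>" "\<theta> ` s = S"
      using finite_linear_orders_isomorphic[OF r s w _ S(2)] S(3) by (metis subset_UNIV)
    have inj: "inj_on \<theta> s" using \<theta>(1) by (simp add: order_embedding_on_def)
    have card_\<theta>: "card (\<theta> ` s') = card s'" if "s' \<subseteq> s" for s'
      using inj that by (meson card_image inj_on_subset)
    have \<gamma>: "fst (p (card s')) (rank w (\<theta> ` s') ` t) = \<gamma> t (\<theta> ` s')" if "s' \<subseteq> s" "t \<subseteq> \<theta> ` s'" for s' t
    proof -
      have sub: "\<theta> ` s' \<subseteq> S" using \<theta>(2) that by auto
      have "fst (colour w \<gamma> e (\<theta> ` s')) (rank w (\<theta> ` s') ` t) = \<gamma> t (\<theta> ` s')"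
        using that(2) finite_subset[OF sub S(2)] by (intro colour_image_rank[OF w]) auto
      then show ?thesis using col[OF sub] card_\<theta>[OF that(1)] by simp
    qed
    have "b (card s') = G (\<theta> ` s') \<and> (\<forall>s''\<subseteq>s'. \<Phi> r s'' s' = \<gamma> (\<theta> ` s'') (\<theta> ` s'))" if s': "s' \<subseteq> s" for s'
    proof (intro conjI allI impI)
      have sub: "\<theta> ` s' \<subseteq> S" using \<theta>(2) s' by auto
      have fin: "finite (\<theta> ` s')" using finite_subset[OF sub S(2)] .
      have "rank w (\<theta> ` s') ` (\<theta> ` s') = {..<card s'}"
        using bij_betw_rank[OF w _ fin] card_\<theta>[OF s'] by (simp add: bij_betw_def)
      then have "fst (p (card s')) {..<card s'} = \<gamma> (\<theta> ` s') (\<theta> ` s')"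
        using \<gamma>[OF s', of "\<theta> ` s'"] by simp
      moreover have "\<gamma> (\<theta> ` s') (\<theta> ` s') \<in> Hom K (G (\<theta> ` s')) (G (\<theta> ` s'))"
        using realizationD(3)[OF re fin] sub S(1) by blast
      ultimately show "b (card s') = G (\<theta> ` s')" unfolding b_def using HomD by metis
      fix s'' assume s'': "s'' \<subseteq> s'"
      have "rank w (\<theta> ` s') (\<theta> y) = rank r s' y" if "y \<in> s'" for y
        using rank_embedding[OF order_embedding_on_subset[OF \<theta>(1) s'] that] .
      then have "rank w (\<theta> ` s') ` (\<theta> ` s'') = rank r s' ` s''"
        using s'' by (auto simp: image_image intro!: image_cong)
      then show "\<Phi> r s'' s' = \<gamma> (\<theta> ` s'') (\<theta> ` s')"
        unfolding \<Phi>_def using \<gamma>[OF s', of "\<theta> ` s''"] s'' by (simp add: image_mono)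
    qed
    moreover have "e (\<theta> y) = e0" if "y \<in> s" for y
    proof -
      have "colour w \<gamma> e {\<theta> y} = p 1" using col[of "{\<theta> y}"] \<theta>(2) that by auto
      then have "snd (colour w \<gamma> e {\<theta> y}) = e0" unfolding e0_def by simp
      then show ?thesis by (simp add: colour_def)
    qed
    ultimately show ?thesis using re S(1,2) \<theta>
      by (intro exI[of _ X] exI[of _ a] exI[of _ G] exI[of _ \<gamma>] exI[of _ e] exI[of _ S] exI[of _ \<theta>]) simp
  qed
  have "order_invariant_diagram K \<A> b \<Phi>"
  proof unfold_locales
    fix n
    obtain s :: "'u set" where s: "finite s" "card s = n"
      using infinite_universe[OF inacc] infinite_arbitrarily_large by metis
    from realize[OF w subset_UNIV s(1)] show "finitely_presentable K (b n)"
    proof (elim exE conjE)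
      fix X a G \<gamma> e S \<theta>
      assume re: "realization X a G \<gamma> e" "finite S" "S \<subseteq> X" and \<theta>: "\<theta> ` s = S"
        and b: "\<forall>s'\<subseteq>s. b (card s') = G (\<theta> ` s') \<and> (\<forall>s''\<subseteq>s'. \<Phi> w s'' s' = \<gamma> (\<theta> ` s'') (\<theta> ` s'))"
      have "b (card s) = G S" using b \<theta> by blast
      then show ?thesis using realizationD(1)[OF re] s presentable by simp
    qed
  next
    fix s s' r r' and f :: "'u \<Rightarrow> 'u"
    assume f: "order_embedding_on s r r' f" and s': "s' \<subseteq> s"
    have "rank r' (f ` s) ` (f ` s') = rank r s ` s'"
      using rank_embedding[OF f] s' by (auto simp: image_image subset_iff intro!: image_cong)
    moreover have "card (f ` s) = card s" using f by (simp add: order_embedding_on_def card_image)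
    ultimately show "\<Phi> r' (f ` s') (f ` s) = \<Phi> r s' s" by (simp add: \<Phi>_def)
  next
    fix Y s :: "'u set" and r assume r: "linear_order_on Y r" and s: "s \<subseteq> Y" "finite s"
    obtain X a G \<gamma> e S \<theta> where re: "realization X a G \<gamma> e" and S: "finite S" "S \<subseteq> X"
      and \<theta>: "order_embedding_on s r w \<theta>" "\<theta> ` s = S"
      and b\<Phi>: "\<forall>s'\<subseteq>s. b (card s') = G (\<theta> ` s') \<and> (\<forall>s''\<subseteq>s'. \<Phi> r s'' s' = \<gamma> (\<theta> ` s'') (\<theta> ` s'))"
      and e: "\<forall>y\<in>s. e (\<theta> y) = e0"
      using realize[OF r s] by (elim exE conjE) (rule that)
    have b: "b (card s') = G (\<theta> ` s')" if "s' \<subseteq> s" for s' using b\<Phi> that by simp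
    have \<Phi>: "\<Phi> r s'' s' = \<gamma> (\<theta> ` s'') (\<theta> ` s')" if "s' \<subseteq> s" "s'' \<subseteq> s'" for s' s''
      using b\<Phi> that by simp
    note re_S = realizationD[OF re S]
    show "\<Phi> r s s = Ide K (b (card s))" using re_S(2) \<Phi> b \<theta>(2) by simp
    show "\<Phi> r s' s \<in> Hom K (b (card s')) (b (card s))" if "s' \<subseteq> s" for s'
      using re_S(3)[of "\<theta> ` s'"] \<Phi>[OF subset_refl that] b[OF that] b[OF subset_refl] \<theta>(2) that by auto
    show "\<Phi> r s'' s = Comp K (\<Phi> r s' s) (\<Phi> r s'' s')" if "s' \<subseteq> s" "s'' \<subseteq> s'" for s' s''
    proof -
      have "\<theta> ` s' \<subseteq> S" "\<theta> ` s'' \<subseteq> \<theta> ` s'" "s'' \<subseteq> s" using \<theta>(2) that by auto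
      then show ?thesis
        using re_S(4)[of "\<theta> ` s'" "\<theta> ` s''"] \<Phi>[OF subset_refl \<open>s'' \<subseteq> s\<close>]
          \<Phi>[OF subset_refl that(1)] \<Phi>[OF that] \<theta>(2) by metis
    qed
    show "\<Phi> r {y} s \<noteq> \<Phi> r {z} s" if yz: "y \<in> s" "z \<in> s" "y \<noteq> z" for y z
    proof -
      have "\<theta> y \<noteq> \<theta> z" using \<theta>(1) yz by (auto simp: order_embedding_on_def dest: inj_onD)
      then have "Comp K (\<gamma> {\<theta> y} S) e0 \<noteq> Comp K (\<gamma> {\<theta> z} S) e0"
        using re_S(5)[of "\<theta> y" "\<theta> z"] \<theta>(2) yz e by auto
      then show ?thesis using \<Phi>[OF subset_refl, of "{y}"] \<Phi>[OF subset_refl, of "{z}"] yz \<theta>(2) by auto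
    qed
  qed
  then show ?thesis by blast
qed


section \<open>Linear orders and their directed colimits\<close>

lemma Lin_Obj_iff: "X \<in> Obj Lin \<longleftrightarrow> small (fst X) \<and> linear_order_on (fst X) (snd X)"
  by (cases X) (simp add: Lin_def)

abbreviation lin_map :: "'u linord \<times> ('u \<Rightarrow> 'u) \<times> 'u linord \<Rightarrow> 'u \<Rightarrow> 'u" where
  "lin_map f \<equiv> fst (snd f)"

lemma Hom_Lin_iff:
  "f \<in> Hom Lin X Z \<longleftrightarrow> X \<in> Obj Lin \<and> Z \<in> Obj Lin \<and> f = (X, lin_map f, Z) \<and>
     lin_map f \<in> fst X \<rightarrow>\<^sub>E fst Z \<and> inj_on (lin_map f) (fst X) \<and>
     (\<forall>a b. (a, b) \<in> snd X \<longrightarrow> (lin_map f a, lin_map f b) \<in> snd Z)"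
  by (cases f; cases X; cases Z) (auto simp: Hom_def Lin_def)

lemma lin_map_Comp: "lin_map (Comp Lin g f) = compose (fst (fst f)) (lin_map g) (lin_map f)"
  by (cases f; cases g) (auto simp: Lin_def)

lemma lin_map_Comp_Hom:
  "f \<in> Hom Lin X Y \<Longrightarrow> x \<in> fst X \<Longrightarrow> lin_map (Comp Lin g f) x = lin_map g (lin_map f x)"
  unfolding lin_map_Comp by (auto simp: Hom_def Lin_def compose_def)

lemma lin_map_image_Comp:
  assumes "f \<in> Hom Lin X Y" "s \<subseteq> fst X"
  shows "lin_map (Comp Lin g f) ` s = lin_map g ` lin_map f ` s"
proof -
  have "lin_map (Comp Lin g f) x = lin_map g (lin_map f x)" if "x \<in> s" for x
    using lin_map_Comp_Hom[OF assms(1)] assms(2) that by blast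
  then show ?thesis by (simp add: image_image cong: image_cong)
qed

lemma Hom_Lin_order_embedding:
  assumes f: "f \<in> Hom Lin X Z"
  shows "order_embedding_on (fst X) (snd X) (snd Z) (lin_map f)"
  unfolding order_embedding_on_def
proof (intro conjI ballI iffI)
  have X: "linear_order_on (fst X) (snd X)" and Z: "linear_order_on (fst Z) (snd Z)"
    and mono: "\<And>a b. (a, b) \<in> snd X \<Longrightarrow> (lin_map f a, lin_map f b) \<in> snd Z"
    using f by (auto simp: Hom_Lin_iff Lin_Obj_iff)
  show inj: "inj_on (lin_map f) (fst X)" using f by (auto simp: Hom_Lin_iff)
  fix y z assume yz: "y \<in> fst X" "z \<in> fst X"
  show "(lin_map f y, lin_map f z) \<in> snd Z" if "(y, z) \<in> snd X" using mono that .
  assume le: "(lin_map f y, lin_map f z) \<in> snd Z"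
  show "(y, z) \<in> snd X"
  proof (rule ccontr)
    assume no: "(y, z) \<notin> snd X"
    then have "(z, y) \<in> snd X" using linear_orderD(2)[OF X yz] by blast
    then have "lin_map f y = lin_map f z" using linear_orderD(4)[OF Z le] mono by blast
    then have "y = z" using inj yz by (auto dest: inj_onD)
    then show False using no linear_orderD(1)[OF X] yz by blast
  qed
qed

lemma linear_order_on_restrict:
  "linear_order_on Y r \<Longrightarrow> Y' \<subseteq> Y \<Longrightarrow> linear_order_on Y' (r \<inter> Y' \<times> Y')"
  unfolding order_on_defs refl_on_def total_on_def trans_def antisym_def by blast

text \<open>
  The images of the legs form a suborder \<open>X'\<close> of \<open>X\<close> through which the colimit cocone factors. The
  induced map \<open>X \<rightarrow> X'\<close> followed by the inclusion is the identity by uniqueness, so \<open>X' = X\<close>.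
\<close>

lemma Lin_colimit_covered:
  assumes fun_D: "cat_functor (poset_cat I r) Lin D" and dir: "directed_poset I r"
    and colim: "is_colimit (poset_cat I r) Lin D X t" and x: "x \<in> fst X"
  shows "\<exists>i\<in>I. x \<in> lin_map (t i) ` fst (omap D i)"
proof -
  interpret category Lin by (rule category_Lin)
  note r = directed_posetD(3)[OF dir]
  have X: "X \<in> Obj Lin" using colimit_Obj[OF colim] .
  note t = colimit_leg[OF colim]
  define U where "U = (\<Union>i\<in>I. lin_map (t i) ` fst (omap D i))"
  have t_X: "lin_map (t i) y \<in> fst X" if "i \<in> I" "y \<in> fst (omap D i)" for i y
    using t[OF that(1)] that(2) unfolding Hom_Lin_iff by blast
  then have U: "U \<subseteq> fst X" by (auto simp: U_def)
  define X' where "X' = (U, snd X \<inter> U \<times> U)"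
  have X': "X' \<in> Obj Lin"
    using X linear_order_on_restrict[OF _ U] small_for_subset[OF _ U]
    unfolding Lin_Obj_iff X'_def small_for_small[symmetric] by auto
  define s where "s i = (omap D i, lin_map (t i), X')" for i
  have s: "s i \<in> Hom Lin (omap D i) X'" if i: "i \<in> I" for i
  proof -
    have "lin_map (t i) y \<in> U" if "y \<in> fst (omap D i)" for y using i that by (auto simp: U_def)
    moreover have "y \<in> fst (omap D i) \<and> z \<in> fst (omap D i)" if "(y, z) \<in> snd (omap D i)" for y z
      using that t[OF i] linear_order_onD unfolding Hom_Lin_iff Lin_Obj_iff by metis
    ultimately show ?thesis
      using t[OF i] X' unfolding Hom_Lin_iff s_def X'_def by (auto simp: PiE_iff)
  qed
  obtain h where h: "h \<in> Hom Lin X X'" "\<And>i. i \<in> I \<Longrightarrow> Comp Lin h (t i) = s i"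
  proof (rule colimit_factor[OF colim X' s])
    fix i j assume ij: "(i, j) \<in> r"
    then have ij': "i \<in> I" "j \<in> I" using r by auto
    have d: "amap D (i, j) \<in> Hom Lin (omap D i) (omap D j)" using poset_functorD(2)[OF fun_D ij] .
    have "lin_map (Comp Lin (s j) (amap D (i, j))) = lin_map (Comp Lin (t j) (amap D (i, j)))"
      unfolding lin_map_Comp by (simp add: s_def)
    also have "\<dots> = lin_map (s i)" using colimit_compat[OF colim ij] by (simp add: s_def)
    finally show "Comp Lin (s j) (amap D (i, j)) = s i"
      using Comp_in_Hom[OF d s[OF ij'(2)]] s[OF ij'(1)] unfolding Hom_Lin_iff by metis
  qed (assumption, rule that)
  define k where "k = (X, lin_map h, X)"
  have k: "k \<in> Hom Lin X X"
    using h(1) X U unfolding Hom_Lin_iff k_def X'_def by (auto simp: PiE_iff)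
  have "k = Ide Lin X"
  proof (rule colimit_eqI[OF fun_D r colim k Ide_in_Hom[OF X]])
    fix i assume i: "i \<in> I"
    have "lin_map (Comp Lin k (t i)) = lin_map (Comp Lin h (t i))"
      unfolding lin_map_Comp by (simp add: k_def)
    then have "lin_map (Comp Lin k (t i)) = lin_map (t i)" using h(2)[OF i] by (simp add: s_def)
    then have "Comp Lin k (t i) = t i"
      using Comp_in_Hom[OF t[OF i] k] t[OF i] unfolding Hom_Lin_iff by metis
    then show "Comp Lin k (t i) = Comp Lin (Ide Lin X) (t i)" using Ide_Comp[OF t[OF i]] by simp
  qed
  then have "lin_map h x = x" using x by (cases X) (auto simp: k_def Lin_def)
  moreover have "lin_map h x \<in> U" using h(1) x unfolding Hom_Lin_iff X'_def by auto
  ultimately show ?thesis by (auto simp: U_def)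
qed

lemma Lin_colimit_finite_subset:
  assumes fun_D: "cat_functor (poset_cat I r) Lin D" and dir: "directed_poset I r"
    and colim: "is_colimit (poset_cat I r) Lin D X t" and s: "s \<subseteq> fst X" "finite s"
  shows "\<exists>i\<in>I. \<exists>s'\<subseteq>fst (omap D i). finite s' \<and> lin_map (t i) ` s' = s"
proof -
  interpret category Lin by (rule category_Lin)
  have "\<forall>x\<in>s. \<exists>i\<in>I. x \<in> lin_map (t i) ` fst (omap D i)"
    using Lin_colimit_covered[OF fun_D dir colim] s by blast
  then obtain i where i: "\<And>x. x \<in> s \<Longrightarrow> i x \<in> I" "\<And>x. x \<in> s \<Longrightarrow> x \<in> lin_map (t (i x)) ` fst (omap D (i x))"
    by metis
  have "finite (i ` s)" "i ` s \<subseteq> I" using i(1) s(2) by auto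
  then obtain k where k': "k \<in> I" "\<And>j. j \<in> i ` s \<Longrightarrow> (j, k) \<in> r"
    by (rule directed_poset_finite_bound[OF dir]) (rule that)
  then have k: "k \<in> I" "\<And>x. x \<in> s \<Longrightarrow> (i x, k) \<in> r" by auto
  have "x \<in> lin_map (t k) ` fst (omap D k)" if x: "x \<in> s" for x
  proof -
    obtain y where y: "y \<in> fst (omap D (i x))" "x = lin_map (t (i x)) y" using i(2)[OF x] by blast
    have d: "amap D (i x, k) \<in> Hom Lin (omap D (i x)) (omap D k)"
      using poset_functorD(2)[OF fun_D k(2)[OF x]] .
    have "x = lin_map (t k) (lin_map (amap D (i x, k)) y)"
      using colimit_compat[OF colim k(2)[OF x]] lin_map_Comp_Hom[OF d y(1)] y(2) by metis
    moreover have "lin_map (amap D (i x, k)) y \<in> fst (omap D k)"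
      using d y(1) unfolding Hom_Lin_iff by blast
    ultimately show ?thesis by blast
  qed
  then have "s \<subseteq> lin_map (t k) ` fst (omap D k)" by blast
  then obtain s' where "s' \<subseteq> fst (omap D k)" "finite s'" "s = lin_map (t k) ` s'"
    using finite_subset_image[OF s(2)] by metis
  then show ?thesis using k(1) by blast
qed


section \<open>Extension of the diagram to all linear orders\<close>

definition Fpow_rel :: "'x set \<Rightarrow> 'x set rel" where
  "Fpow_rel Y = {(s', s). s' \<subseteq> s \<and> s \<in> Fpow Y}"

lemma Fpow_relD: "(s', s) \<in> Fpow_rel Y \<Longrightarrow> s' \<subseteq> s \<and> s \<subseteq> Y \<and> finite s \<and> s' \<subseteq> Y \<and> finite s'"
  unfolding Fpow_rel_def Fpow_def using finite_subset by blast

lemma directed_poset_Fpow: "directed_poset (Fpow Y) (Fpow_rel Y)"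
  unfolding directed_poset_def partial_order_on_def preorder_on_def
proof (intro conjI ballI)
  show "refl_on (Fpow Y) (Fpow_rel Y)" "trans (Fpow_rel Y)" "antisym (Fpow_rel Y)"
    by (auto simp: refl_on_def trans_def antisym_def Fpow_rel_def Fpow_def)
  show "Fpow_rel Y \<subseteq> Fpow Y \<times> Fpow Y" by (auto dest: Fpow_relD simp: Fpow_def)
  show "Fpow Y \<noteq> {}" by (auto simp: Fpow_def)
  show "\<exists>u\<in>Fpow Y. (s, u) \<in> Fpow_rel Y \<and> (s', u) \<in> Fpow_rel Y"
    if "s \<in> Fpow Y" "s' \<in> Fpow Y" for s s'
    using that by (intro bexI[of _ "s \<union> s'"]) (auto simp: Fpow_rel_def Fpow_def)
qed

context order_invariant_diagram
begin

abbreviation fin_cat :: "'a linord \<Rightarrow> ('a set, 'a set \<times> 'a set) cat" where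
  "fin_cat X \<equiv> poset_cat (Fpow (fst X)) (Fpow_rel (fst X))"

definition diagram :: "'a linord \<Rightarrow> ('a set, 'a set \<times> 'a set, 'a, 'a) func" where
  "diagram X = \<lparr>omap = \<lambda>s. b (card s), amap = \<lambda>(s', s). \<Phi> (snd X) s' s\<rparr>"

lemma diagram_simps [simp]:
  "omap (diagram X) s = b (card s)" "amap (diagram X) (s', s) = \<Phi> (snd X) s' s"
  by (simp_all add: diagram_def)

lemma diagram_functor:
  assumes X: "X \<in> Obj Lin"
  shows "cat_functor (fin_cat X) K (diagram X)"
proof (rule poset_functorI[OF category_axioms directed_posetD(1)[OF directed_poset_Fpow]])
  have r: "linear_order_on (fst X) (snd X)" using X by (simp add: Lin_Obj_iff)
  show "omap (diagram X) s \<in> Obj K" for s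
    using b_presentable by (simp add: finitely_presentable_def)
  show "amap (diagram X) (s', s) \<in> Hom K (omap (diagram X) s') (omap (diagram X) s)"
    if "(s', s) \<in> Fpow_rel (fst X)" for s' s
    using Fpow_relD[OF that] \<Phi>_Hom[OF r] by simp
  show "amap (diagram X) (s, s) = Ide K (omap (diagram X) s)" if "s \<in> Fpow (fst X)" for s
    using that \<Phi>_Ide[OF r] by (simp add: Fpow_def)
  show "amap (diagram X) (s'', s) = Comp K (amap (diagram X) (s', s)) (amap (diagram X) (s'', s'))"
    if "(s'', s') \<in> Fpow_rel (fst X)" "(s', s) \<in> Fpow_rel (fst X)" for s'' s' s
    using Fpow_relD[OF that(1)] Fpow_relD[OF that(2)] \<Phi>_Comp[OF r] by simp
qed

text \<open>
  The left Kan extension along the inclusion of the finite linear orders into \<open>Lin\<close>, computed at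
  \<open>X\<close> as a colimit over the finite subsets of \<open>X\<close>; the colimit object is paired with its legs.
\<close>

definition ext :: "'a linord \<Rightarrow> 'a \<times> ('a set \<Rightarrow> 'a)" where
  "ext X = (SOME c. is_colimit (fin_cat X) K (diagram X) (fst c) (snd c))"

abbreviation ext_ob :: "'a linord \<Rightarrow> 'a" where "ext_ob X \<equiv> fst (ext X)"
abbreviation \<iota> :: "'a linord \<Rightarrow> 'a set \<Rightarrow> 'a" where "\<iota> X \<equiv> snd (ext X)"

lemma small_Fpow:
  fixes X :: "'a linord"
  shows "X \<in> Obj Lin \<Longrightarrow> small_for TYPE('a) (Fpow (fst X))"
  by (rule small_for_subset[OF small_for_Pow[OF inacc, of "fst X"]])
    (auto simp: Lin_Obj_iff small_for_small Fpow_def)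

lemma ext_colimit:
  assumes X: "X \<in> Obj Lin"
  shows "is_colimit (fin_cat X) K (diagram X) (ext_ob X) (\<iota> X)"
proof -
  have "\<exists>c. is_colimit (fin_cat X) K (diagram X) (fst c) (snd c)"
    using directed_colimit_exists[OF small_Fpow[OF X] directed_poset_Fpow diagram_functor[OF X]] by simp
  then show ?thesis unfolding ext_def by (rule someI_ex)
qed

lemma \<iota>_Hom: "X \<in> Obj Lin \<Longrightarrow> s \<subseteq> fst X \<Longrightarrow> finite s \<Longrightarrow> \<iota> X s \<in> Hom K (b (card s)) (ext_ob X)"
  using colimit_leg[OF ext_colimit, of X s] by (simp add: Fpow_def)

lemma \<iota>_compat: "X \<in> Obj Lin \<Longrightarrow> s \<subseteq> fst X \<Longrightarrow> finite s \<Longrightarrow> s' \<subseteq> s \<Longrightarrow>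
    Comp K (\<iota> X s) (\<Phi> (snd X) s' s) = \<iota> X s'"
  using colimit_compat[OF ext_colimit, of X s' s] by (simp add: Fpow_def Fpow_rel_def)

lemma ext_eqI:
  assumes X: "X \<in> Obj Lin" and h: "h \<in> Hom K (ext_ob X) y" "h' \<in> Hom K (ext_ob X) y"
    and "\<And>s. s \<subseteq> fst X \<Longrightarrow> finite s \<Longrightarrow> Comp K h (\<iota> X s) = Comp K h' (\<iota> X s)"
  shows "h = h'"
  using assms(4)
  by (intro colimit_eqI[OF diagram_functor[OF X] directed_posetD(3)[OF directed_poset_Fpow]
        ext_colimit[OF X] h]) (simp add: Fpow_def)

lemma ext_factor:
  assumes X: "X \<in> Obj Lin" and y: "y \<in> Obj K"
    and "\<And>s. s \<subseteq> fst X \<Longrightarrow> finite s \<Longrightarrow> \<tau> s \<in> Hom K (b (card s)) y"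
    and "\<And>s s'. s \<subseteq> fst X \<Longrightarrow> finite s \<Longrightarrow> s' \<subseteq> s \<Longrightarrow> Comp K (\<tau> s) (\<Phi> (snd X) s' s) = \<tau> s'"
  obtains h where "h \<in> Hom K (ext_ob X) y"
    "\<And>s. s \<subseteq> fst X \<Longrightarrow> finite s \<Longrightarrow> Comp K h (\<iota> X s) = \<tau> s"
proof -
  obtain h where "h \<in> Hom K (ext_ob X) y" "\<And>s. s \<in> Fpow (fst X) \<Longrightarrow> Comp K h (\<iota> X s) = \<tau> s"
  proof (rule colimit_factor[OF ext_colimit[OF X] y])
    show "\<tau> s \<in> Hom K (omap (diagram X) s) y" if "s \<in> Fpow (fst X)" for s
      using assms(3) that by (simp add: Fpow_def)
    show "Comp K (\<tau> s) (amap (diagram X) (s', s)) = \<tau> s'" if "(s', s) \<in> Fpow_rel (fst X)" for s' s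
      using assms(4) Fpow_relD[OF that] by simp
  qed (rule that)
  then show thesis using that by (simp add: Fpow_def)
qed

lemma ext_arrow_exists:
  assumes f: "f \<in> Hom Lin X Z"
  shows "\<exists>h. h \<in> Hom K (ext_ob X) (ext_ob Z) \<and>
    (\<forall>s. s \<subseteq> fst X \<and> finite s \<longrightarrow> Comp K h (\<iota> X s) = \<iota> Z (lin_map f ` s))"
proof -
  have X: "X \<in> Obj Lin" and Z: "Z \<in> Obj Lin" and im: "\<And>s. s \<subseteq> fst X \<Longrightarrow> lin_map f ` s \<subseteq> fst Z"
    and inj: "inj_on (lin_map f) (fst X)"
    using f unfolding Hom_Lin_iff by auto
  have emb: "order_embedding_on s (snd X) (snd Z) (lin_map f)" if "s \<subseteq> fst X" for s
    using order_embedding_on_subset[OF Hom_Lin_order_embedding[OF f] that] .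
  have card: "card (lin_map f ` s) = card s" if "s \<subseteq> fst X" for s
    using inj that by (meson card_image inj_on_subset)
  obtain h where "h \<in> Hom K (ext_ob X) (ext_ob Z)"
    "\<And>s. s \<subseteq> fst X \<Longrightarrow> finite s \<Longrightarrow> Comp K h (\<iota> X s) = \<iota> Z (lin_map f ` s)"
  proof (rule ext_factor[OF X, of "ext_ob Z" "\<lambda>s. \<iota> Z (lin_map f ` s)"])
    show "ext_ob Z \<in> Obj K" using colimit_Obj[OF ext_colimit[OF Z]] .
    show "\<iota> Z (lin_map f ` s) \<in> Hom K (b (card s)) (ext_ob Z)" if "s \<subseteq> fst X" "finite s" for s
      using \<iota>_Hom[OF Z im[OF that(1)]] that card by simp
    show "Comp K (\<iota> Z (lin_map f ` s)) (\<Phi> (snd X) s' s) = \<iota> Z (lin_map f ` s')"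
      if "s \<subseteq> fst X" "finite s" "s' \<subseteq> s" for s s'
      using \<iota>_compat[OF Z im[OF that(1)], of "lin_map f ` s'"] \<Phi>_embedding[OF emb[OF that(1)] that(3)] that
      by (simp add: image_mono)
  qed (use that in blast)
  then show ?thesis by blast
qed

definition ext_functor :: "('a linord, 'a linord \<times> ('a \<Rightarrow> 'a) \<times> 'a linord, 'a, 'a) func" where
  "ext_functor = \<lparr>omap = ext_ob,
     amap = \<lambda>f. SOME h. h \<in> Hom K (ext_ob (Dom Lin f)) (ext_ob (Cod Lin f)) \<and>
       (\<forall>s. s \<subseteq> fst (Dom Lin f) \<and> finite s \<longrightarrow>
          Comp K h (\<iota> (Dom Lin f) s) = \<iota> (Cod Lin f) (lin_map f ` s))\<rparr>"

lemma omap_ext_functor [simp]: "omap ext_functor X = ext_ob X"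
  by (simp add: ext_functor_def)

lemma amap_ext_functor:
  assumes f: "f \<in> Hom Lin X Z"
  shows "amap ext_functor f \<in> Hom K (ext_ob X) (ext_ob Z)"
    and "s \<subseteq> fst X \<Longrightarrow> finite s \<Longrightarrow> Comp K (amap ext_functor f) (\<iota> X s) = \<iota> Z (lin_map f ` s)"
proof -
  have "Dom Lin f = X" "Cod Lin f = Z" using f by (auto simp: Hom_def)
  then have "amap ext_functor f = (SOME h. h \<in> Hom K (ext_ob X) (ext_ob Z) \<and>
      (\<forall>s. s \<subseteq> fst X \<and> finite s \<longrightarrow> Comp K h (\<iota> X s) = \<iota> Z (lin_map f ` s)))"
    by (simp add: ext_functor_def)
  with someI_ex[OF ext_arrow_exists[OF f]]
  have *: "amap ext_functor f \<in> Hom K (ext_ob X) (ext_ob Z) \<and>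
      (\<forall>s. s \<subseteq> fst X \<and> finite s \<longrightarrow> Comp K (amap ext_functor f) (\<iota> X s) = \<iota> Z (lin_map f ` s))"
    by simp
  then show "amap ext_functor f \<in> Hom K (ext_ob X) (ext_ob Z)"
    "s \<subseteq> fst X \<Longrightarrow> finite s \<Longrightarrow> Comp K (amap ext_functor f) (\<iota> X s) = \<iota> Z (lin_map f ` s)"
    by blast+
qed

lemma ext_cat_functor: "cat_functor Lin K ext_functor"
proof -
  interpret Lin: category Lin by (rule category_Lin)
  show ?thesis
  proof
    show "omap ext_functor X \<in> Obj K" if "X \<in> Obj Lin" for X
      using colimit_Obj[OF ext_colimit[OF that]] by simp
    show "amap ext_functor f \<in> Hom K (omap ext_functor X) (omap ext_functor Y)"
      if "f \<in> Hom Lin X Y" for f X Y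
      using amap_ext_functor(1)[OF that] by simp
    show "amap ext_functor (Ide Lin X) = Ide K (omap ext_functor X)" if X: "X \<in> Obj Lin" for X
    proof -
      note id = Lin.Ide_in_Hom[OF X]
      have ob: "ext_ob X \<in> Obj K" using colimit_Obj[OF ext_colimit[OF X]] .
      have "amap ext_functor (Ide Lin X) = Ide K (ext_ob X)"
      proof (rule ext_eqI[OF X amap_ext_functor(1)[OF id] Ide_in_Hom[OF ob]])
        fix s assume s: "s \<subseteq> fst X" "finite s"
        have "lin_map (Ide Lin X) x = x" if "x \<in> s" for x
          using that s by (cases X) (auto simp: Lin_def)
        then have "lin_map (Ide Lin X) ` s = s" by simp
        then show "Comp K (amap ext_functor (Ide Lin X)) (\<iota> X s) = Comp K (Ide K (ext_ob X)) (\<iota> X s)"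
          using amap_ext_functor(2)[OF id s] Ide_Comp[OF \<iota>_Hom[OF X s]] by simp
      qed
      then show ?thesis by simp
    qed
    fix f g and X Y Z :: "'a linord"
    assume f: "f \<in> Hom Lin X Y" and g: "g \<in> Hom Lin Y Z"
    have X: "X \<in> Obj Lin" using f unfolding Hom_Lin_iff by blast
    note gf = Lin.Comp_in_Hom[OF f g]
    note E = amap_ext_functor(1)
    show "amap ext_functor (Comp Lin g f) = Comp K (amap ext_functor g) (amap ext_functor f)"
    proof (rule ext_eqI[OF X E[OF gf] Comp_in_Hom[OF E[OF f] E[OF g]]])
      fix s assume s: "s \<subseteq> fst X" "finite s"
      have im: "lin_map f ` s \<subseteq> fst Y" "finite (lin_map f ` s)" using f s unfolding Hom_Lin_iff by auto
      show "Comp K (amap ext_functor (Comp Lin g f)) (\<iota> X s)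
          = Comp K (Comp K (amap ext_functor g) (amap ext_functor f)) (\<iota> X s)"
        using amap_ext_functor(2)[OF gf s] amap_ext_functor(2)[OF f s] amap_ext_functor(2)[OF g im]
          Comp_assoc[OF \<iota>_Hom[OF X s] E[OF f] E[OF g]] lin_map_image_Comp[OF f s(1)] by simp
    qed
  qed
qed

text \<open>
  Suppose that the functor identifies \<open>f\<close> and \<open>g\<close> and that these differ at \<open>x\<close>. Then the legs at \<open>{f x}\<close> and \<open>{g x}\<close>
  coincide. As \<open>b 1\<close> is finitely presentable, the points \<open>f x\<close> and \<open>g x\<close> are already identified on
  a finite set \<open>u\<close>, contrary to \<open>\<Phi>_points\<close>.
\<close>

lemma ext_faithful: "faithful Lin K ext_functor"
  unfolding faithful_def
proof (intro ballI inj_onI)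
  fix X Z f g assume X: "X \<in> Obj Lin" and Z: "Z \<in> Obj Lin"
    and f: "f \<in> Hom Lin X Z" and g: "g \<in> Hom Lin X Z"
    and eq: "amap ext_functor f = amap ext_functor g"
  have r: "linear_order_on (fst Z) (snd Z)" using Z by (simp add: Lin_Obj_iff)
  have "lin_map f x = lin_map g x" if x: "x \<in> fst X" for x
  proof (rule ccontr)
    assume neq: "lin_map f x \<noteq> lin_map g x"
    let ?y = "lin_map f x" and ?z = "lin_map g x"
    let ?s = "{?y, ?z}"
    have yz: "?y \<in> fst Z" "?z \<in> fst Z" using f g x unfolding Hom_Lin_iff by blast+
    have \<Phi>: "\<Phi> (snd Z) {w} ?s \<in> Hom K (b 1) (b (card ?s))" if "w \<in> ?s" for w
      using \<Phi>_Hom[OF r, of ?s "{w}"] yz that by auto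
    have "\<iota> Z {?y} = \<iota> Z {?z}"
      using amap_ext_functor(2)[OF f, of "{x}"] amap_ext_functor(2)[OF g, of "{x}"] eq x by simp
    then have "Comp K (\<iota> Z ?s) (\<Phi> (snd Z) {?y} ?s) = Comp K (\<iota> Z ?s) (\<Phi> (snd Z) {?z} ?s)"
      using \<iota>_compat[OF Z, of ?s "{?y}"] \<iota>_compat[OF Z, of ?s "{?z}"] yz by simp
    then have "\<exists>u. (?s, u) \<in> Fpow_rel (fst Z) \<and>
        Comp K (amap (diagram Z) (?s, u)) (\<Phi> (snd Z) {?y} ?s)
        = Comp K (amap (diagram Z) (?s, u)) (\<Phi> (snd Z) {?z} ?s)"
      using \<Phi>[of ?y] \<Phi>[of ?z] yz
      by (intro presentable_eq[OF b_presentable small_Fpow[OF Z] directed_poset_Fpow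
            diagram_functor[OF Z] ext_colimit[OF Z]]) (simp_all add: Fpow_def)
    then obtain u where u: "(?s, u) \<in> Fpow_rel (fst Z)"
      "Comp K (\<Phi> (snd Z) ?s u) (\<Phi> (snd Z) {?y} ?s) = Comp K (\<Phi> (snd Z) ?s u) (\<Phi> (snd Z) {?z} ?s)"
      by auto
    note u' = Fpow_relD[OF u(1)]
    have "\<Phi> (snd Z) {?y} u = \<Phi> (snd Z) {?z} u"
      using u(2) \<Phi>_Comp[OF r, of u ?s "{?y}"] \<Phi>_Comp[OF r, of u ?s "{?z}"] u' by simp
    then show False using \<Phi>_points[OF r, of u ?y ?z] u' neq by simp
  qed
  then have "lin_map f = lin_map g" using f g unfolding Hom_Lin_iff by (meson PiE_ext)
  then show "f = g" using f g unfolding Hom_Lin_iff by metis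
qed

text \<open>
  A cocone \<open>\<sigma>\<close> on the image of the diagram has to be extended to \<open>X\<close>, that is, to a cocone on the
  finite subsets of \<open>X\<close>. Each of them lifts to a finite subset of some stage, where \<open>\<sigma>\<close> applies;
  order invariance of \<open>\<Phi>\<close> makes the result compatible with inclusions.
\<close>

lemma ext_preserves_directed_colimits: "preserves_directed_colimits TYPE('a) Lin K ext_functor"
  unfolding preserves_directed_colimits_def
proof (intro allI impI, elim conjE)
  fix I :: "'a set" and r and D :: "('a, 'a \<times> 'a, 'a linord, 'a linord \<times> ('a \<Rightarrow> 'a) \<times> 'a linord) func"
    and X t
  assume dir: "directed_poset I r" and fun_D: "cat_functor (poset_cat I r) Lin D"
    and colim: "is_colimit (poset_cat I r) Lin D X t"
  interpret Lin: category Lin by (rule category_Lin)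
  interpret E: cat_functor Lin K ext_functor by (rule ext_cat_functor)
  note r = directed_posetD[OF dir]
  note t = Lin.colimit_leg[OF colim] and t_compat = Lin.colimit_compat[OF colim]
  note d = poset_functorD(2)[OF fun_D] and D_Obj = poset_functorD(1)[OF fun_D]
  have X: "X \<in> Obj Lin" using Lin.colimit_Obj[OF colim] .
  have Fd: "amap ext_functor (amap D (i, j)) \<in> Hom K (ext_ob (omap D i)) (ext_ob (omap D j))"
    if "(i, j) \<in> r" for i j using amap_ext_functor(1)[OF d[OF that]] .
  have Ft: "amap ext_functor (t i) \<in> Hom K (ext_ob (omap D i)) (ext_ob X)" if "i \<in> I" for i
    using amap_ext_functor(1)[OF t[OF that]] .
  show "is_colimit (poset_cat I r) K (func_comp ext_functor D) (omap ext_functor X) (amap ext_functor \<circ> t)"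
    unfolding is_colimit_def
  proof (intro conjI allI impI)
    show "cocone (poset_cat I r) K (func_comp ext_functor D) (omap ext_functor X) (amap ext_functor \<circ> t)"
      unfolding cocone_poset_iff
    proof (intro conjI ballI allI impI)
      show "omap ext_functor X \<in> Obj K" using E.omap_in_Obj[OF X] .
      show "(amap ext_functor \<circ> t) i \<in> Hom K (omap (func_comp ext_functor D) i) (omap ext_functor X)"
        if "i \<in> I" for i using Ft[OF that] by (simp add: func_comp_def)
      fix i j assume ij: "(i, j) \<in> r"
      then have j: "j \<in> I" using r(3) by auto
      show "Comp K ((amap ext_functor \<circ> t) j) (amap (func_comp ext_functor D) (i, j)) = (amap ext_functor \<circ> t) i"
        using E.amap_Comp[OF d[OF ij] t[OF j]] t_compat[OF ij] by (simp add: func_comp_def)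
    qed
  next
    fix y \<sigma> assume "cocone (poset_cat I r) K (func_comp ext_functor D) y \<sigma>"
    then have y: "y \<in> Obj K" and \<sigma>: "\<And>i. i \<in> I \<Longrightarrow> \<sigma> i \<in> Hom K (ext_ob (omap D i)) y"
      and \<sigma>_compat: "\<And>i j. (i, j) \<in> r \<Longrightarrow> Comp K (\<sigma> j) (amap ext_functor (amap D (i, j))) = \<sigma> i"
      unfolding cocone_poset_iff by (auto simp: func_comp_def)
    define lifts where "lifts S i s \<longleftrightarrow> i \<in> I \<and> s \<subseteq> fst (omap D i) \<and> finite s \<and> lin_map (t i) ` s = S" for S i s
    have lifts: "\<exists>i s. lifts S i s" if "S \<subseteq> fst X" "finite S" for S
      using Lin_colimit_finite_subset[OF fun_D dir colim that] unfolding lifts_def by blast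
    let ?v = "\<lambda>i s. Comp K (\<sigma> i) (\<iota> (omap D i) s)"
    have push: "?v i s = ?v k (lin_map (amap D (i, k)) ` s)"
      if i: "i \<in> I" and s: "s \<subseteq> fst (omap D i)" "finite s" and ik: "(i, k) \<in> r" for i s k
    proof -
      have k: "k \<in> I" using ik r(3) by auto
      have "?v i s = Comp K (Comp K (\<sigma> k) (amap ext_functor (amap D (i, k)))) (\<iota> (omap D i) s)"
        using \<sigma>_compat[OF ik] by simp
      also have "\<dots> = ?v k (lin_map (amap D (i, k)) ` s)"
        using Comp_assoc[OF \<iota>_Hom[OF D_Obj[OF i] s] Fd[OF ik] \<sigma>[OF k]]
          amap_ext_functor(2)[OF d[OF ik] s] by simp
      finally show ?thesis .
    qed
    \<comment> \<open>Two lifts of the same finite set become equal further along, as the legs are injective.\<close>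
    have v_unique: "?v i s = ?v j s'" if i: "lifts S i s" and j: "lifts S j s'" for S i s j s'
    proof -
      have i': "i \<in> I" "s \<subseteq> fst (omap D i)" "finite s" "lin_map (t i) ` s = S"
        and j': "j \<in> I" "s' \<subseteq> fst (omap D j)" "finite s'" "lin_map (t j) ` s' = S"
        using i j unfolding lifts_def by auto
      obtain k where k: "k \<in> I" "(i, k) \<in> r" "(j, k) \<in> r" using r(6)[OF i'(1) j'(1)] by blast
      have "lin_map (t k) ` lin_map (amap D (i, k)) ` s = S"
        using lin_map_image_Comp[OF d[OF k(2)] i'(2)] t_compat[OF k(2)] i'(4) by metis
      moreover have "lin_map (t k) ` lin_map (amap D (j, k)) ` s' = S"
        using lin_map_image_Comp[OF d[OF k(3)] j'(2)] t_compat[OF k(3)] j'(4) by metis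
      moreover have "inj_on (lin_map (t k)) (fst (omap D k))" using t[OF k(1)] unfolding Hom_Lin_iff by blast
      moreover have "lin_map (amap D (i, k)) ` s \<subseteq> fst (omap D k)"
        using d[OF k(2)] i'(2) unfolding Hom_Lin_iff by blast
      moreover have "lin_map (amap D (j, k)) ` s' \<subseteq> fst (omap D k)"
        using d[OF k(3)] j'(2) unfolding Hom_Lin_iff by blast
      ultimately have "lin_map (amap D (i, k)) ` s = lin_map (amap D (j, k)) ` s'"
        by (metis inj_on_image_eq_iff)
      then show ?thesis using push[OF i'(1-3) k(2)] push[OF j'(1-3) k(3)] by simp
    qed
    define \<tau> where "\<tau> S = (SOME v. \<exists>i s. lifts S i s \<and> v = ?v i s)" for S
    have \<tau>: "\<tau> S = ?v i s" if li: "lifts S i s" for S i s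
    proof -
      have "\<exists>v i s. lifts S i s \<and> v = ?v i s" using li by blast
      from someI_ex[OF this] obtain j s' where "lifts S j s'" "\<tau> S = ?v j s'" unfolding \<tau>_def by blast
      then show ?thesis using v_unique li by metis
    qed
    obtain h where h: "h \<in> Hom K (ext_ob X) y" "\<And>S. S \<subseteq> fst X \<Longrightarrow> finite S \<Longrightarrow> Comp K h (\<iota> X S) = \<tau> S"
    proof (rule ext_factor[OF X y, of \<tau>])
      fix S assume S: "S \<subseteq> fst X" "finite S"
      then obtain i s where li: "lifts S i s" using lifts by blast
      then have i: "i \<in> I" and s: "s \<subseteq> fst (omap D i)" "finite s" and S_eq: "lin_map (t i) ` s = S"
        unfolding lifts_def by auto
      have emb: "order_embedding_on s (snd (omap D i)) (snd X) (lin_map (t i))"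
        using order_embedding_on_subset[OF Hom_Lin_order_embedding[OF t[OF i]] s(1)] .
      then have "card S = card s" using S_eq by (auto simp: order_embedding_on_def card_image)
      then show "\<tau> S \<in> Hom K (b (card S)) y"
        using \<tau>[OF li] Comp_in_Hom[OF \<iota>_Hom[OF D_Obj[OF i] s] \<sigma>[OF i]] by simp
      fix S' assume S': "S' \<subseteq> S"
      then obtain s' where s': "s' \<subseteq> s" "S' = lin_map (t i) ` s'" using S_eq by (metis subset_imageE)
      have "lifts S' i s'" using i s s' finite_subset unfolding lifts_def by blast
      then have "\<tau> S' = ?v i s'" by (rule \<tau>)
      moreover have "\<Phi> (snd X) S' S = \<Phi> (snd (omap D i)) s' s"
        using \<Phi>_embedding[OF emb s'(1)] s'(2) S_eq by simp
      moreover have "linear_order_on (fst (omap D i)) (snd (omap D i))"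
        using D_Obj[OF i] by (simp add: Lin_Obj_iff)
      ultimately show "Comp K (\<tau> S) (\<Phi> (snd X) S' S) = \<tau> S'"
        using \<tau>[OF li] Comp_assoc[OF \<Phi>_Hom[OF _ s s'(1)] \<iota>_Hom[OF D_Obj[OF i] s] \<sigma>[OF i]]
          \<iota>_compat[OF D_Obj[OF i] s s'(1)] by simp
    qed (use that in blast)
    have leg: "Comp K (Comp K k (amap ext_functor (t i))) (\<iota> (omap D i) s) = Comp K k (\<iota> X (lin_map (t i) ` s))"
      if "k \<in> Hom K (ext_ob X) y" "i \<in> I" "s \<subseteq> fst (omap D i)" "finite s" for k i s
      using Comp_assoc[OF \<iota>_Hom[OF D_Obj[OF that(2)] that(3,4)] Ft[OF that(2)] that(1)]
        amap_ext_functor(2)[OF t[OF that(2)] that(3,4)] by simp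
    show "\<exists>!h. h \<in> Hom K (omap ext_functor X) y \<and>
        (\<forall>j\<in>Obj (poset_cat I r). Comp K h ((amap ext_functor \<circ> t) j) = \<sigma> j)"
    proof (rule ex1I[of _ h])
      have "Comp K h (amap ext_functor (t i)) = \<sigma> i" if i: "i \<in> I" for i
      proof (rule ext_eqI[OF D_Obj[OF i] Comp_in_Hom[OF Ft[OF i] h(1)] \<sigma>[OF i]])
        fix s assume s: "s \<subseteq> fst (omap D i)" "finite s"
        have "lin_map (t i) ` s \<subseteq> fst X" using t[OF i] s(1) unfolding Hom_Lin_iff by blast
        moreover have "\<tau> (lin_map (t i) ` s) = ?v i s" using i s by (intro \<tau>) (simp add: lifts_def)
        ultimately show "Comp K (Comp K h (amap ext_functor (t i))) (\<iota> (omap D i) s) = ?v i s"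
          using leg[OF h(1) i s] h(2) s(2) by simp
      qed
      then show "h \<in> Hom K (omap ext_functor X) y \<and>
          (\<forall>j\<in>Obj (poset_cat I r). Comp K h ((amap ext_functor \<circ> t) j) = \<sigma> j)"
        using h(1) by simp
    next
      fix k assume "k \<in> Hom K (omap ext_functor X) y \<and>
          (\<forall>j\<in>Obj (poset_cat I r). Comp K k ((amap ext_functor \<circ> t) j) = \<sigma> j)"
      then have k: "k \<in> Hom K (ext_ob X) y" "\<And>i. i \<in> I \<Longrightarrow> Comp K k (amap ext_functor (t i)) = \<sigma> i" by auto
      show "k = h"
      proof (rule ext_eqI[OF X k(1) h(1)])
        fix S assume S: "S \<subseteq> fst X" "finite S"
        then obtain i s where li: "lifts S i s" using lifts by blast
        then have i: "i \<in> I" "s \<subseteq> fst (omap D i)" "finite s" "lin_map (t i) ` s = S" unfolding lifts_def by auto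
        show "Comp K k (\<iota> X S) = Comp K h (\<iota> X S)"
          using leg[OF k(1) i(1-3)] k(2)[OF i(1)] i(4) \<tau>[OF li] h(2)[OF S] by simp
      qed
    qed
  qed
qed

end

theorem theorem3p1:
  fixes K :: "('u, 'u) cat"
  assumes "inaccessible |UNIV :: 'u set|"
    and "finitely_accessible K"
    and "large K"
  shows "\<exists>F. cat_functor (Lin :: ('u linord, _) cat) K F \<and> faithful Lin K F \<and>
    preserves_directed_colimits TYPE('u) Lin K F"
proof -
  obtain \<A> where \<A>: "accessible_presentation K \<A>"
    using assms(1,2)
    unfolding finitely_accessible_def accessible_presentation_def accessible_presentation_axioms_def by blast
  obtain b \<Phi> where "order_invariant_diagram K \<A> b \<Phi>"
    using accessible_presentation.order_invariant_diagram_exists[OF \<A> assms(3)] by blast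
  then interpret order_invariant_diagram K \<A> b \<Phi> .
  show ?thesis using ext_cat_functor ext_faithful ext_preserves_directed_colimits by blast
qed

end
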